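(* Let $\{X_t\}_{t\ge1}$ be a stationary Gaussian AR(1) process, $X_{t+1}=aX_t+\varepsilon_{t+1}$ with $\varepsilon_t$ i.i.d. $N(0,\sigma^2)$, where $|a|<1$ and $\sigma>0$ are unknown. Let $W_2,W_4,\dots$ be the pairwise-betting wealth process defined in the context. Then $\frac{\log(W_{2n})}{2n}\to r^*$ almost surely as $n\to\infty$, where $r^*=\frac12\mathbb{E}\left(\log S_4\right)\ge 0$, and $r^*=0$ if and only if $a=0$.
   Context: For parameters $(a,\sigma^2)$ let $f(x,y,z)=\frac{1}{2\pi\sigma^2}\exp\left(-\frac{(y-ax)^2}{2\sigma^2}-\frac{(z-ay)^2}{2\sigma^2}\right)$, and define the oracle score $S_4=\frac{2f(X_2,X_3,X_4)}{f(X_2,X_3,X_4)+f(X_2,X_4,X_3)}$ using the true $a,\sigma^2$. For odd $t\ge3$, let $\hat a_{t-1}=\sum_{i=2}^{t-1}X_iX_{i-1}/\sum_{i=1}^{t-2}X_i^2$, $\hat\sigma^2_{t-1}=\frac{1}{t-2}\sum_{i=2}^{t-1}(X_i-\hat a_{t-1}X_{i-1})^2$, let $\hat f_{t-1}$ be $f$ with $(a,\sigma^2)$ replaced by $(\hat a_{t-1},\hat\sigma^2_{t-1})$, and $$\hat S_{t+1}=\frac{2\hat{f}_{t-1}(X_{t-1},X_t,X_{t+1})}{\hat{f}_{t-1}(X_{t-1},X_t,X_{t+1})+\hat{f}_{t-1}(X_{t-1},X_{t+1},X_t)}$$ (set to $1$ when the estimates are degenerate). The wealth process is $W_2=1$ and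 $W_{t+1}=W_{t-1}\hat S_{t+1}$ for odd $t\ge3$. *)

theory Defs
  imports "HOL-Probability.Probability"
begin

text \<open>Joint conditional density f(x,y,z) of (X_{t-1},X_t,X_{t+1}) given parameters (a, s2),
  where s2 is the noise variance sigma^2.\<close>
definition ar_f :: "real \<Rightarrow> real \<Rightarrow> real \<Rightarrow> real \<Rightarrow> real \<Rightarrow> real" where
  "ar_f a s2 x y z = 1 / (2 * pi * s2) * exp (- (y - a * x)\<^sup>2 / (2 * s2) - (z - a * y)\<^sup>2 / (2 * s2))"

definition pair_score :: "(real \<Rightarrow> real \<Rightarrow> real \<Rightarrow> real) \<Rightarrow> real \<Rightarrow> real \<Rightarrow> real \<Rightarrow> real" where
  "pair_score g x y z = 2 * g x y z / (g x y z + g x z y)"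

text \<open>Least squares estimates from X_1..X_m (here m = t - 1).\<close>
definition a_hat :: "(nat \<Rightarrow> real) \<Rightarrow> nat \<Rightarrow> real" where
  "a_hat X m = (\<Sum>i = 2..m. X i * X (i - 1)) / (\<Sum>i = 1..m - 1. (X i)\<^sup>2)"

definition s2_hat :: "(nat \<Rightarrow> real) \<Rightarrow> nat \<Rightarrow> real" where
  "s2_hat X m = 1 / real (m - 1) * (\<Sum>i = 2..m. (X i - a_hat X m * X (i - 1))\<^sup>2)"

text \<open>Estimates are degenerate when the denominator of a_hat vanishes or the variance
  estimate is not positive (so that the plug-in density is undefined).\<close>
definition est_degenerate :: "(nat \<Rightarrow> real) \<Rightarrow> nat \<Rightarrow> bool" where
  "est_degenerate X m \<longleftrightarrow> (\<Sum>i = 1..m - 1. (X i)\<^sup>2) = 0 \<or> s2_hat X m \<le> 0"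

text \<open>Plug-in score hat S_{t+1}, for odd t \<ge> 3.\<close>
definition S_hat :: "(nat \<Rightarrow> real) \<Rightarrow> nat \<Rightarrow> real" where
  "S_hat X t = (if est_degenerate X (t - 1) then 1
      else pair_score (ar_f (a_hat X (t - 1)) (s2_hat X (t - 1))) (X (t - 1)) (X t) (X (t + 1)))"

text \<open>Wealth W_{2n}: W_2 = 1 and W_{t+1} = W_{t-1} * hat S_{t+1} for odd t \<ge> 3,
  i.e. W_{2n} = prod_{k=1}^{n-1} hat S_{2k+2} (with t = 2k+1).\<close>
definition wealth :: "(nat \<Rightarrow> real) \<Rightarrow> nat \<Rightarrow> real" where
  "wealth X n = (\<Prod>k \<in> {1..<n}. S_hat X (2 * k + 1))"

end

theory Submission
  imports Defs "HOL-Library.Discrete_Functions"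
begin

text \<open>With \<open>D = log (f(x,y,z) / f(x,z,y))\<close>, a difference of quadratic forms in the data, each log score is
  \<open>ln 2 - ln (1 + exp (- D))\<close>, a 1-Lipschitz function of \<open>D\<close>. Functions of three consecutive observations with
  locally linear-growth Lipschitz constant have exponentially decaying autocovariances, so a second-moment
  strong law applies to them. It yields consistency of the least squares estimates and convergence of the
  averaged oracle log scores; the 1-Lipschitz property bounds the plug-in error by a null sequence times
  \<open>1 + x\<^sup>2 + y\<^sup>2 + z\<^sup>2\<close>, whose averages converge, so it vanishes in the Cesaro mean. Finally
  \<open>log S \<ge> (1 - exp (- D)) / 2\<close> with equality only for \<open>D = 0\<close>, and \<open>exp (- D)\<close> is a likelihood ratio of
  mean 1; hence the growth rate is nonnegative, and zero only if \<open>D = 0\<close> almost surely, i.e. \<open>a = 0\<close>.\<close>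

section \<open>A strong law under exponentially decaying correlations\<close>

text \<open>Two obstacles shape the argument. Consecutive bets share an observation and every
  observation carries its whole past, so the scores are dependent; the strong law therefore asks
  only for upper bounds on covariances. These come from the independence of the noise: the influence
  of an observation on the one \<open>m\<close> steps later shrinks like
  \<open>\<bar>a\<bar> ^ m\<close>. The statistics involved are quadratic in the data, which is why
  the Lipschitz constant has to be allowed to grow and why fourth moments of the process appear. The
  second obstacle is that plug-in scores are not stationary. In \<open>D\<close> the normalising
  constants and the terms in \<open>x\<^sup>2\<close> and \<open>y * z\<close> cancel, and what is
  left is linear in the two coefficients \<open>a\<^sup>2 / (2 * s2)\<close> and
  \<open>a / s2\<close>. Estimation error thus separates into a factor depending on the estimates
  and a factor depending on the three observations, and after the estimates are known to converge
  the comparison with the oracle is purely deterministic, path by path.\<close>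

text \<open>Monotone convergence makes the expected sum of all squares finite, so the sum is finite
  almost surely and its terms vanish. This takes the place of Chebyshev with Borel-Cantelli.\<close>

lemma (in prob_space) AE_tendsto_0_if_summable_second_moment:
  fixes Z :: "nat \<Rightarrow> 'a \<Rightarrow> real"
  assumes [measurable]: "\<And>n. Z n \<in> borel_measurable M"
    and int: "\<And>n. integrable M (\<lambda>\<omega>. (Z n \<omega>)\<^sup>2)"
    and bound: "\<And>n. expectation (\<lambda>\<omega>. (Z n \<omega>)\<^sup>2) \<le> b n"
    and "summable b"
  shows "AE \<omega> in M. (\<lambda>n. Z n \<omega>) \<longlonglongrightarrow> 0"
proof -
  have b0: "0 \<le> b n" for n
    by (rule order_trans[OF _ bound]) simp
  have "(\<integral>\<^sup>+\<omega>. (\<Sum>n. ennreal ((Z n \<omega>)\<^sup>2)) \<partial>M) = (\<Sum>n. \<integral>\<^sup>+\<omega>. ennreal ((Z n \<omega>)\<^sup>2) \<partial>M)"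
    by (rule nn_integral_suminf) measurable
  also have "\<dots> = (\<Sum>n. ennreal (expectation (\<lambda>\<omega>. (Z n \<omega>)\<^sup>2)))"
    by (intro suminf_cong nn_integral_eq_integral int) auto
  also have "\<dots> \<le> (\<Sum>n. ennreal (b n))"
    by (intro suminf_le bound ennreal_leI) auto
  also have "\<dots> = ennreal (\<Sum>n. b n)"
    by (intro suminf_ennreal2 b0 \<open>summable b\<close>)
  finally have "(\<integral>\<^sup>+\<omega>. (\<Sum>n. ennreal ((Z n \<omega>)\<^sup>2)) \<partial>M) \<noteq> \<infinity>"
    by (metis ennreal_less_top infinity_ennreal_def leD)
  then have "AE \<omega> in M. (\<Sum>n. ennreal ((Z n \<omega>)\<^sup>2)) \<noteq> \<infinity>"
    by (intro nn_integral_PInf_AE) measurable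
  then show ?thesis
  proof eventually_elim
    case (elim \<omega>)
    then have "summable (\<lambda>n. (Z n \<omega>)\<^sup>2)"
      by (intro summable_suminf_not_top) auto
    then have "(\<lambda>n. (Z n \<omega>)\<^sup>2) \<longlonglongrightarrow> 0"
      by (rule summable_LIMSEQ_zero)
    then show ?case
      by (simp add: tendsto_power_zero power_tendsto_0_iff)
  qed
qed

text \<open>Bounds, uniformly in \<open>n\<close>, the total covariance of a new summand with all
  earlier ones.\<close>

lemma sum_power_rev_le:
  fixes \<rho> :: real
  assumes "0 \<le> \<rho>" "\<rho> < 1"
  shows "(\<Sum>i<n. \<rho> ^ (n - i)) \<le> 1 / (1 - \<rho>)"
proof -
  have "(\<Sum>i<n. \<rho> ^ (n - i)) = (\<Sum>i<n. \<rho> ^ Suc i)"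
    by (subst sum.nat_diff_reindex[symmetric]) (auto intro!: sum.cong arg_cong[where f="power \<rho>"])
  also have "\<dots> \<le> (\<Sum>i<n. \<rho> ^ i)"
    using assms by (intro sum_mono) (simp add: mult_left_le_one_le)
  also have "\<dots> = (1 - \<rho> ^ n) / (1 - \<rho>)"
    using assms by (simp add: sum_gp_strict)
  also have "\<dots> \<le> 1 / (1 - \<rho>)"
    using assms by (intro divide_right_mono) auto
  finally show ?thesis .
qed

text \<open>Chebyshev along the squares \<open>n\<^sup>2\<close>; between consecutive squares the partial sums are controlled by
  the sum \<open>R n\<close> of absolute values over the block, whose second moment is \<open>O(n\<^sup>2)\<close>.\<close>
lemma (in prob_space) slln_of_correlation_decay:
  fixes Y :: "nat \<Rightarrow> 'a \<Rightarrow> real"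
  assumes [measurable]: "\<And>k. Y k \<in> borel_measurable M"
    and int: "\<And>i j. integrable M (\<lambda>\<omega>. Y i \<omega> * Y j \<omega>)"
    and \<rho>: "0 \<le> \<rho>" "\<rho> < 1"
    and decay: "\<And>i j. i \<le> j \<Longrightarrow> expectation (\<lambda>\<omega>. Y i \<omega> * Y j \<omega>) \<le> C * \<rho> ^ (j - i)"
  shows "AE \<omega> in M. (\<lambda>n. (\<Sum>k<n. Y k \<omega>) / real n) \<longlonglongrightarrow> 0"
proof -
  define S where "S n \<omega> = (\<Sum>k<n. Y k \<omega>)" for n \<omega>
  define R where "R n \<omega> = (\<Sum>k\<in>{n\<^sup>2..<(Suc n)\<^sup>2}. \<bar>Y k \<omega>\<bar>)" for n \<omega>
  have [measurable]: "S n \<in> borel_measurable M" "R n \<in> borel_measurable M" for n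
    unfolding S_def R_def by measurable
  have int2: "integrable M (\<lambda>\<omega>. (Y i \<omega>)\<^sup>2)" for i
    using int[of i i] by (simp add: power2_eq_square)
  have EY2: "expectation (\<lambda>\<omega>. (Y i \<omega>)\<^sup>2) \<le> C" for i
    using decay[of i i] by (simp add: power2_eq_square)
  have C0: "0 \<le> C"
    by (rule order_trans[OF _ EY2[of 0]]) simp
  \<comment> \<open>Passing from \<open>n\<close> to \<open>n + 1\<close> summands adds one
    variance, at most \<open>C\<close>, and twice the covariances with the past, a geometric sum.
    Hence the second moment of \<open>S n\<close> grows at most linearly with slope
    \<open>K\<close>.\<close>
  define K where "K = C + 2 * (C / (1 - \<rho>))"
  have K0: "0 \<le> K"
    using C0 \<rho> by (auto simp: K_def)
  have S2: "integrable M (\<lambda>\<omega>. (S n \<omega>)\<^sup>2) \<and> expectation (\<lambda>\<omega>. (S n \<omega>)\<^sup>2) \<le> K * real n" for n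
  proof (induction n)
    case 0
    then show ?case by (simp add: S_def)
  next
    case (Suc n)
    have eq: "(S (Suc n) \<omega>)\<^sup>2 = (S n \<omega>)\<^sup>2 + 2 * (\<Sum>i<n. Y i \<omega> * Y n \<omega>) + (Y n \<omega>)\<^sup>2" for \<omega>
      by (simp add: S_def power2_sum sum_distrib_right)
    have "expectation (\<lambda>\<omega>. (S (Suc n) \<omega>)\<^sup>2) = expectation (\<lambda>\<omega>. (S n \<omega>)\<^sup>2)
        + 2 * (\<Sum>i<n. expectation (\<lambda>\<omega>. Y i \<omega> * Y n \<omega>)) + expectation (\<lambda>\<omega>. (Y n \<omega>)\<^sup>2)"
      unfolding eq using Suc int int2 by simp
    also have "\<dots> \<le> K * real n + 2 * (\<Sum>i<n. C * \<rho> ^ (n - i)) + C"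
      using Suc EY2[of n] decay by (intro add_mono mult_left_mono sum_mono) auto
    also have "(\<Sum>i<n. C * \<rho> ^ (n - i)) \<le> C * (1 / (1 - \<rho>))"
      unfolding sum_distrib_left[symmetric] using C0 \<rho> by (intro mult_left_mono sum_power_rev_le)
    finally show ?case
      using Suc int int2 by (auto simp: eq K_def distrib_left add_ac)
  qed
  have summ: "summable (\<lambda>n. c / (real n)\<^sup>2)" for c
    using inverse_power_summable[of 2, where 'a=real]
    by (auto simp: divide_inverse power_inverse intro!: summable_mult)
  have Z: "AE \<omega> in M. (\<lambda>n. S (n\<^sup>2) \<omega> / (real n)\<^sup>2) \<longlonglongrightarrow> 0"
  proof (rule AE_tendsto_0_if_summable_second_moment[OF _ _ _ summ[of K]])
    fix n
    show "integrable M (\<lambda>\<omega>. (S (n\<^sup>2) \<omega> / (real n)\<^sup>2)\<^sup>2)"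
      unfolding power_divide using S2 by simp
    show "expectation (\<lambda>\<omega>. (S (n\<^sup>2) \<omega> / (real n)\<^sup>2)\<^sup>2) \<le> K / (real n)\<^sup>2"
    \<comment> \<open>At \<open>n = 0\<close> both sides are 0, as division by 0 yields 0.\<close>
    proof (cases "n = 0")
      case False
      have "expectation (\<lambda>\<omega>. (S (n\<^sup>2) \<omega> / (real n)\<^sup>2)\<^sup>2) = expectation (\<lambda>\<omega>. (S (n\<^sup>2) \<omega>)\<^sup>2) / (real n) ^ 4"
        by (simp add: power_divide)
      also have "\<dots> \<le> K * real (n\<^sup>2) / (real n) ^ 4"
        using S2[of "n\<^sup>2"] by (intro divide_right_mono) auto
      also have "\<dots> = K / (real n)\<^sup>2"
        using False by (simp add: field_simps power2_eq_square power4_eq_xxxx)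
      finally show ?thesis .
    qed simp
  qed measurable
  have R2: "integrable M (\<lambda>\<omega>. (R n \<omega>)\<^sup>2) \<and> expectation (\<lambda>\<omega>. (R n \<omega>)\<^sup>2) \<le> C * (real (2 * n + 1))\<^sup>2" for n
  proof
    have card: "card {n\<^sup>2..<(Suc n)\<^sup>2} = 2 * n + 1"
      by (simp add: power2_eq_square)
    \<comment> \<open>Cauchy-Schwarz over the \<open>2 * n + 1\<close> indices between consecutive
      squares; no decay of correlations is used inside a block.\<close>
    have le: "(R n \<omega>)\<^sup>2 \<le> (\<Sum>k\<in>{n\<^sup>2..<(Suc n)\<^sup>2}. (Y k \<omega>)\<^sup>2) * real (2 * n + 1)" for \<omega>
      using sum_squared_le_sum_of_squares[of "\<lambda>k. \<bar>Y k \<omega>\<bar>" "{n\<^sup>2..<(Suc n)\<^sup>2}"]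
      unfolding R_def card by simp
    have i: "integrable M (\<lambda>\<omega>. (\<Sum>k\<in>{n\<^sup>2..<(Suc n)\<^sup>2}. (Y k \<omega>)\<^sup>2) * real (2 * n + 1))"
      using int2 by auto
    show ii: "integrable M (\<lambda>\<omega>. (R n \<omega>)\<^sup>2)"
      by (rule Bochner_Integration.integrable_bound[OF i])
         (auto intro!: AE_I2 order_trans[OF le])
    have "expectation (\<lambda>\<omega>. (R n \<omega>)\<^sup>2)
        \<le> expectation (\<lambda>\<omega>. (\<Sum>k\<in>{n\<^sup>2..<(Suc n)\<^sup>2}. (Y k \<omega>)\<^sup>2) * real (2 * n + 1))"
      by (intro integral_mono i ii le)
    also have "\<dots> = (\<Sum>k\<in>{n\<^sup>2..<(Suc n)\<^sup>2}. expectation (\<lambda>\<omega>. (Y k \<omega>)\<^sup>2)) * real (2 * n + 1)"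
      using int2 by simp
    also have "\<dots> \<le> (\<Sum>k\<in>{n\<^sup>2..<(Suc n)\<^sup>2}. C) * real (2 * n + 1)"
      by (intro mult_right_mono sum_mono EY2) auto
    also have "\<dots> = C * (real (2 * n + 1))\<^sup>2"
      unfolding sum_constant card by (simp add: power2_eq_square)
    finally show "expectation (\<lambda>\<omega>. (R n \<omega>)\<^sup>2) \<le> C * (real (2 * n + 1))\<^sup>2" .
  qed
  have Z': "AE \<omega> in M. (\<lambda>n. R n \<omega> / (real n)\<^sup>2) \<longlonglongrightarrow> 0"
  proof (rule AE_tendsto_0_if_summable_second_moment[OF _ _ _ summ[of "9 * C"]])
    fix n
    show "integrable M (\<lambda>\<omega>. (R n \<omega> / (real n)\<^sup>2)\<^sup>2)"
      unfolding power_divide using R2 by simp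
    show "expectation (\<lambda>\<omega>. (R n \<omega> / (real n)\<^sup>2)\<^sup>2) \<le> 9 * C / (real n)\<^sup>2"
    proof (cases "n = 0")
      case False
      have "expectation (\<lambda>\<omega>. (R n \<omega> / (real n)\<^sup>2)\<^sup>2) = expectation (\<lambda>\<omega>. (R n \<omega>)\<^sup>2) / (real n) ^ 4"
        by (simp add: power_divide)
      also have "\<dots> \<le> C * (real (2 * n + 1))\<^sup>2 / (real n) ^ 4"
        using R2 by (intro divide_right_mono) auto
      \<comment> \<open>\<open>2 * n + 1 \<le> 3 * n\<close> for positive \<open>n\<close>, whence
        the 9.\<close>
      also have "\<dots> \<le> C * (3 * real n)\<^sup>2 / (real n) ^ 4"
        using False C0 by (intro divide_right_mono mult_left_mono power_mono) auto
      also have "\<dots> = 9 * C / (real n)\<^sup>2"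
        using False by (simp add: field_simps power2_eq_square power4_eq_xxxx)
      finally show ?thesis .
    qed simp
  qed measurable
  from Z Z' show ?thesis
  proof eventually_elim
    case (elim \<omega>)
    have "(\<lambda>n. \<bar>S (n\<^sup>2) \<omega> / (real n)\<^sup>2\<bar> + R n \<omega> / (real n)\<^sup>2) \<longlonglongrightarrow> 0"
      using tendsto_add[OF tendsto_rabs_zero[OF elim(1)] elim(2)] by simp
    \<comment> \<open>Both limits along \<open>n\<close> are now read at
      \<open>n = floor_sqrt m\<close>, the root of the last square not exceeding
      \<open>m\<close>.\<close>
    moreover have "filterlim floor_sqrt at_top sequentially"
      unfolding filterlim_at_top
    proof
      fix Z
      show "\<forall>\<^sub>F n in sequentially. Z \<le> floor_sqrt n"
        using eventually_ge_at_top[of "Z\<^sup>2"] by eventually_elim (rule le_floor_sqrtI)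
    qed
    ultimately have lim: "(\<lambda>m. \<bar>S ((floor_sqrt m)\<^sup>2) \<omega> / (real (floor_sqrt m))\<^sup>2\<bar>
        + R (floor_sqrt m) \<omega> / (real (floor_sqrt m))\<^sup>2) \<longlonglongrightarrow> 0"
      by (rule filterlim_compose)
    show ?case
    proof (rule Lim_null_comparison[OF _ lim], rule eventually_mono[OF eventually_ge_at_top[of 1]])
      fix m :: nat
      assume "1 \<le> m"
      define n where "n = floor_sqrt m"
      have n: "0 < n" "n\<^sup>2 \<le> m" "m < (Suc n)\<^sup>2"
        using \<open>1 \<le> m\<close> Suc_floor_sqrt_power2_gt[of m] by (auto simp: n_def)
      have "S m \<omega> = S (n\<^sup>2) \<omega> + (\<Sum>k\<in>{n\<^sup>2..<m}. Y k \<omega>)"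
        unfolding S_def lessThan_atLeast0
        using n by (subst sum.atLeastLessThan_concat) auto
      moreover have "\<bar>\<Sum>k\<in>{n\<^sup>2..<m}. Y k \<omega>\<bar> \<le> (\<Sum>k\<in>{n\<^sup>2..<m}. \<bar>Y k \<omega>\<bar>)"
        by (rule sum_abs)
      moreover have "\<dots> \<le> R n \<omega>"
        unfolding R_def using n by (intro sum_mono2) auto
      ultimately have "\<bar>S m \<omega>\<bar> \<le> \<bar>S (n\<^sup>2) \<omega>\<bar> + R n \<omega>"
        by linarith
      moreover have "(real n)\<^sup>2 \<le> real m"
        using n by (metis of_nat_le_iff of_nat_power)
      ultimately have "\<bar>S m \<omega>\<bar> / real m \<le> (\<bar>S (n\<^sup>2) \<omega>\<bar> + R n \<omega>) / (real n)\<^sup>2"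
        using n by (intro frac_le) auto
      then show "norm ((\<Sum>k<m. Y k \<omega>) / real m) \<le> \<bar>S ((floor_sqrt m)\<^sup>2) \<omega> / (real (floor_sqrt m))\<^sup>2\<bar>
        + R (floor_sqrt m) \<omega> / (real (floor_sqrt m))\<^sup>2"
        by (simp add: n_def[symmetric] S_def[symmetric] add_divide_distrib)
    qed
  qed
qed

text \<open>The weights \<open>w\<close> may be unbounded; convergence of their averages is enough.
  Finitely many early terms contribute \<open>A / n\<close>, and the rest is at most a small
  multiple of an average of \<open>w\<close>. It is applied with \<open>u\<close> the plug-in and
  \<open>v\<close> the oracle log scores.\<close>

lemma cesaro_perturbation:
  fixes u v w \<delta> :: "nat \<Rightarrow> real"
  assumes le: "\<forall>\<^sub>F k in sequentially. \<bar>u k - v k\<bar> \<le> \<delta> k * w k"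
    and "\<delta> \<longlonglongrightarrow> 0"
    and w: "\<And>k. 0 \<le> w k" "(\<lambda>n. (\<Sum>k<n. w k) / real n) \<longlonglongrightarrow> B"
    and v: "(\<lambda>n. (\<Sum>k<n. v k) / real n) \<longlonglongrightarrow> L"
  shows "(\<lambda>n. (\<Sum>k<n. u k) / real n) \<longlonglongrightarrow> L"
proof -
  have "(\<lambda>n. (\<Sum>k<n. u k - v k) / real n) \<longlonglongrightarrow> 0"
  proof (rule LIMSEQ_I)
    fix e :: real
    assume "0 < e"
    have B0: "0 \<le> B"
      by (rule LIMSEQ_le_const[OF w(2)]) (auto intro!: exI[of _ 0] divide_nonneg_nonneg sum_nonneg w)
    \<comment> \<open>The averages of \<open>w\<close> are eventually below \<open>B + 1\<close>, so
      the tail costs at most \<open>d * (B + 1) = e / 2\<close>.\<close>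
    define d where "d = e / (2 * (B + 1))"
    have d: "0 < d" using \<open>0 < e\<close> B0 by (simp add: d_def)
    have "\<forall>\<^sub>F k in sequentially. \<bar>\<delta> k\<bar> < d"
      using tendstoD[OF \<open>\<delta> \<longlonglongrightarrow> 0\<close> d] by simp
    with le have "\<forall>\<^sub>F k in sequentially. \<bar>u k - v k\<bar> \<le> d * w k"
    proof eventually_elim
      case (elim k)
      have "\<delta> k * w k \<le> d * w k"
        using elim w(1)[of k] by (intro mult_right_mono) auto
      with elim show ?case by linarith
    qed
    then obtain N where N: "\<And>k. k \<ge> N \<Longrightarrow> \<bar>u k - v k\<bar> \<le> d * w k"
      by (auto simp: eventually_sequentially)
    define A where "A = (\<Sum>k<N. \<bar>u k - v k\<bar>)"
    have "(\<lambda>n. A / real n) \<longlonglongrightarrow> 0"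
      by (rule lim_const_over_n)
    then have "\<forall>\<^sub>F n in sequentially. \<bar>A / real n\<bar> < e / 2"
      using tendstoD[of _ 0 sequentially "e/2"] \<open>0 < e\<close> by force
    moreover have "\<forall>\<^sub>F n in sequentially. (\<Sum>k<n. w k) / real n < B + 1"
      using order_tendstoD(2)[OF w(2), of "B + 1"] by simp
    ultimately have "\<forall>\<^sub>F n in sequentially. norm ((\<Sum>k<n. u k - v k) / real n - 0) < e"
      using eventually_ge_at_top[of "Suc N"]
    proof eventually_elim
      case (elim n)
      have "\<bar>\<Sum>k<n. u k - v k\<bar> \<le> (\<Sum>k<n. \<bar>u k - v k\<bar>)"
        by (rule sum_abs)
      also have "\<dots> = A + (\<Sum>k\<in>{N..<n}. \<bar>u k - v k\<bar>)"
        unfolding A_def lessThan_atLeast0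
        using elim by (subst sum.atLeastLessThan_concat) auto
      also have "(\<Sum>k\<in>{N..<n}. \<bar>u k - v k\<bar>) \<le> (\<Sum>k\<in>{N..<n}. d * w k)"
        by (intro sum_mono N) auto
      also have "\<dots> \<le> (\<Sum>k<n. d * w k)"
        using d w(1) by (intro sum_mono2) auto
      also have "\<dots> = d * (\<Sum>k<n. w k)"
        by (simp add: sum_distrib_left)
      finally have "\<bar>\<Sum>k<n. u k - v k\<bar> / real n \<le> (A + d * (\<Sum>k<n. w k)) / real n"
        by (intro divide_right_mono) auto
      also have "\<dots> = A / real n + d * ((\<Sum>k<n. w k) / real n)"
        by (simp add: add_divide_distrib)
      also have "\<dots> < e / 2 + d * (B + 1)"
        using elim(1,2) d abs_ge_self[of "A / real n"]
        by (intro add_less_le_mono mult_left_mono order.strict_trans1[of "A / real n" "\<bar>A / real n\<bar>"]) (auto simp del: abs_divide)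
      also have "d * (B + 1) = e / 2"
        using B0 by (simp add: d_def field_simps)
      finally show ?case by simp
    qed
    then show "\<exists>no. \<forall>n\<ge>no. norm ((\<Sum>k<n. u k - v k) / real n - 0) < e"
      by (simp add: eventually_sequentially)
  qed
  from tendsto_add[OF this v] show ?thesis
    by (simp add: sum_subtractf diff_divide_distrib)
qed

section \<open>Gaussian AR(1) processes\<close>

text \<open>One class for everything that has to be averaged: it contains the quadratic monomials
  and is closed under sums and under globally Lipschitz maps applied to the value, so it covers the
  sums in the estimates as well as the log scores.\<close>

definition quad_lipschitz :: "real \<Rightarrow> (real \<Rightarrow> real \<Rightarrow> real \<Rightarrow> real) \<Rightarrow> bool" where
  "quad_lipschitz K g \<longleftrightarrow> (\<forall>x y z x' y' z'. \<bar>g x y z - g x' y' z'\<bar>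
      \<le> K * (1 + \<bar>x\<bar> + \<bar>y\<bar> + \<bar>z\<bar> + \<bar>x'\<bar> + \<bar>y'\<bar> + \<bar>z'\<bar>) * (\<bar>x - x'\<bar> + \<bar>y - y'\<bar> + \<bar>z - z'\<bar>))"

lemma quad_lipschitzD:
  "quad_lipschitz K g \<Longrightarrow> \<bar>g x y z - g x' y' z'\<bar>
      \<le> K * (1 + \<bar>x\<bar> + \<bar>y\<bar> + \<bar>z\<bar> + \<bar>x'\<bar> + \<bar>y'\<bar> + \<bar>z'\<bar>) * (\<bar>x - x'\<bar> + \<bar>y - y'\<bar> + \<bar>z - z'\<bar>)"
  unfolding quad_lipschitz_def by blast

lemma quad_lipschitz_nonneg: "quad_lipschitz K g \<Longrightarrow> 0 \<le> K"
  using quad_lipschitzD[of K g 1 0 0 0 0 0] by simp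

lemma integrable_if_abs_le:
  fixes f g :: "'a \<Rightarrow> real"
  assumes "integrable M f" "g \<in> borel_measurable M" "\<And>x. \<bar>g x\<bar> \<le> f x"
  shows "integrable M g"
  using assms by (intro Bochner_Integration.integrable_bound[of M f g])
    (auto intro!: AE_I2 intro: order_trans[OF _ abs_ge_self])

text \<open>The bound \<open>(u + v)\<^sup>2 \<le> 2 * (u\<^sup>2 + v\<^sup>2)\<close> applied at
  two levels; the constant is \<open>4 ^ 3\<close>, as in the power mean inequality.\<close>

lemma power4_sum4_le:
  fixes p q r s :: real
  shows "(p + q + r + s) ^ 4 \<le> 64 * (p ^ 4 + q ^ 4 + r ^ 4 + s ^ 4)"
proof -
  have two: "(u + v)\<^sup>2 \<le> 2 * (u\<^sup>2 + v\<^sup>2)" for u v :: real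
    using sum_squares_bound[of u v] by (simp add: power2_sum)
  have "(p + q + r + s)\<^sup>2 \<le> 2 * ((p + q)\<^sup>2 + (r + s)\<^sup>2)"
    using two[of "p + q" "r + s"] by (simp add: add.assoc)
  also have "\<dots> \<le> 4 * ((p\<^sup>2 + q\<^sup>2) + (r\<^sup>2 + s\<^sup>2))"
    using two[of p q] two[of r s] by argo
  finally have "((p + q + r + s)\<^sup>2)\<^sup>2 \<le> (4 * ((p\<^sup>2 + q\<^sup>2) + (r\<^sup>2 + s\<^sup>2)))\<^sup>2"
    by (intro power_mono) auto
  also have "\<dots> \<le> 16 * (2 * ((p\<^sup>2 + q\<^sup>2)\<^sup>2 + (r\<^sup>2 + s\<^sup>2)\<^sup>2))"
    using mult_left_mono[OF two[of "p\<^sup>2 + q\<^sup>2" "r\<^sup>2 + s\<^sup>2"], of 16]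
    by (simp add: power_mult_distrib del: distrib_left_numeral)
  also have "\<dots> \<le> 64 * ((p\<^sup>2)\<^sup>2 + (q\<^sup>2)\<^sup>2 + (r\<^sup>2)\<^sup>2 + (s\<^sup>2)\<^sup>2)"
    using two[of "p\<^sup>2" "q\<^sup>2"] two[of "r\<^sup>2" "s\<^sup>2"] by argo
  finally show ?thesis
    by simp
qed

text \<open>Stationarity is encoded in the start: \<open>eps 1\<close> is not a noise term but the
  initial value, drawn from the stationary law. Every observation is then a function of one
  independent family.\<close>

locale gaussian_ar1 = prob_space M for M :: "'w measure" +
  fixes X eps :: "nat \<Rightarrow> 'w \<Rightarrow> real" and a \<sigma> :: real
  assumes a_bound: "\<bar>a\<bar> < 1" and \<sigma>_pos: "0 < \<sigma>"
    and indep_eps: "indep_vars (\<lambda>_. borel) eps {1..}"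
    and eps_1: "distributed M lborel (eps 1) (normal_density 0 (\<sigma> / sqrt (1 - a\<^sup>2)))"
    and eps_distr: "\<And>t. 2 \<le> t \<Longrightarrow> distributed M lborel (eps t) (normal_density 0 \<sigma>)"
    and X_1: "X 1 = eps 1"
    and X_Suc: "\<And>t. 1 \<le> t \<Longrightarrow> X (Suc t) = (\<lambda>\<omega>. a * X t \<omega> + eps (Suc t) \<omega>)"
begin

text \<open>The stationary standard deviation, fixed by the variance recursion
  \<open>\<tau>2\<close>.\<close>

definition \<tau> :: real where "\<tau> = \<sigma> / sqrt (1 - a\<^sup>2)"

lemma one_minus_a2_pos: "0 < 1 - a\<^sup>2"
  using a_bound by (simp add: abs_square_less_1)

lemma \<tau>_pos: "0 < \<tau>"
  using \<sigma>_pos one_minus_a2_pos by (simp add: \<tau>_def)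

lemma \<tau>2: "\<tau>\<^sup>2 = a\<^sup>2 * \<tau>\<^sup>2 + \<sigma>\<^sup>2"
  using one_minus_a2_pos by (simp add: \<tau>_def power_divide field_simps)

text \<open>Value at time \<open>t\<close> of the recursion restarted from 0 at time
  \<open>s\<close>. The noise path \<open>e\<close> is an argument so that the same expression can
  be evaluated on restricted paths, that is, on elements of a product space.\<close>

definition noise_sum :: "nat \<Rightarrow> nat \<Rightarrow> (nat \<Rightarrow> real) \<Rightarrow> real" where
  "noise_sum s t e = (\<Sum>i\<in>{s<..t}. a ^ (t - i) * e i)"

lemma noise_sum_refl [simp]: "noise_sum t t e = 0"
  by (simp add: noise_sum_def)

lemma noise_sum_Suc: "s \<le> t \<Longrightarrow> noise_sum s (Suc t) e = a * noise_sum s t e + e (Suc t)"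
proof -
  assume "s \<le> t"
  then have *: "{s<..Suc t} = insert (Suc t) {s<..t}"
    by auto
  show ?thesis
    unfolding noise_sum_def *
    by (simp add: sum_distrib_left Suc_diff_le mult.assoc)
qed

lemma noise_sum_restrict: "{s<..t} \<subseteq> A \<Longrightarrow> noise_sum s t (restrict e A) = noise_sum s t e"
  unfolding noise_sum_def by (intro sum.cong) auto

lemma measurable_noise_sum:
  assumes "{s<..t} \<subseteq> A"
  shows "noise_sum s t \<in> borel_measurable (PiM A (\<lambda>_. borel))"
  unfolding noise_sum_def[abs_def] using assms
  by (intro borel_measurable_sum borel_measurable_times borel_measurable_const
      measurable_component_singleton) auto

text \<open>Splits a later observation into a fading memory of \<open>X s\<close> and a part driven
  only by noise after time \<open>s\<close>.\<close>

lemma X_shift: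
  assumes "1 \<le> s"
  shows "X (s + m) \<omega> = a ^ m * X s \<omega> + noise_sum s (s + m) (\<lambda>i. eps i \<omega>)"
proof (induction m)
  case (Suc m)
  then show ?case
    using assms by (simp add: X_Suc noise_sum_Suc algebra_simps)
qed simp

text \<open>No memory term is left here: since \<open>X 1 = eps 1\<close>, the process behaves as if
  started from 0 at time 0.\<close>

lemma X_eq_noise_sum:
  assumes "1 \<le> t"
  shows "X t \<omega> = noise_sum 0 t (\<lambda>i. eps i \<omega>)"
  using assms
proof (induction t rule: dec_induct)
  case base
  show ?case using noise_sum_Suc[of 0 0 "\<lambda>i. eps i \<omega>"] X_1 by simp
next
  case (step t)
  then show ?case by (simp add: X_Suc noise_sum_Suc)
qed

lemma eps_measurable [measurable]: "1 \<le> t \<Longrightarrow> eps t \<in> borel_measurable M"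
  using indep_eps by (auto simp: indep_vars_def)

lemma X_measurable: "1 \<le> t \<Longrightarrow> X t \<in> borel_measurable M"
proof (induction t rule: dec_induct)
  case base
  show ?case using eps_measurable[of 1] X_1 by simp
next
  case (step t)
  then show ?case using eps_measurable[of "Suc t"] by (simp add: X_Suc)
qed

lemma indep_past_future_restrict:
  "indep_var (PiM {1..s} (\<lambda>_. borel)) (\<lambda>\<omega>. restrict (\<lambda>i. eps i \<omega>) {1..s})
      (PiM {s<..} (\<lambda>_. borel)) (\<lambda>\<omega>. restrict (\<lambda>i. eps i \<omega>) {s<..})"
  by (rule indep_var_restrict[OF indep_eps]) auto

lemma indep_past_future:
  assumes "F \<in> measurable (PiM {1..s} (\<lambda>_. borel)) N1"
    and "G \<in> measurable (PiM {s<..} (\<lambda>_. borel)) N2"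
  shows "indep_var N1 (\<lambda>\<omega>. F (restrict (\<lambda>i. eps i \<omega>) {1..s}))
      N2 (\<lambda>\<omega>. G (restrict (\<lambda>i. eps i \<omega>) {s<..}))"
  using indep_var_compose[OF indep_past_future_restrict assms] by (simp add: comp_def)

text \<open>Unlike \<^const>\<open>indep_var\<close>, this version allows \<open>F\<close> and \<open>G\<close> to have different types.\<close>
lemma distr_past_future:
  assumes [measurable]: "F \<in> measurable (PiM {1..s} (\<lambda>_. borel)) N1"
    and [measurable]: "G \<in> measurable (PiM {s<..} (\<lambda>_. borel)) N2"
  shows "distr M (N1 \<Otimes>\<^sub>M N2) (\<lambda>\<omega>. (F (restrict (\<lambda>i. eps i \<omega>) {1..s}), G (restrict (\<lambda>i. eps i \<omega>) {s<..})))
    = distr M N1 (\<lambda>\<omega>. F (restrict (\<lambda>i. eps i \<omega>) {1..s}))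
      \<Otimes>\<^sub>M distr M N2 (\<lambda>\<omega>. G (restrict (\<lambda>i. eps i \<omega>) {s<..}))"
proof -
  let ?P = "PiM {1..s} (\<lambda>_. borel) :: (nat \<Rightarrow> real) measure"
  let ?Q = "PiM {s<..} (\<lambda>_. borel) :: (nat \<Rightarrow> real) measure"
  let ?p = "\<lambda>\<omega>. restrict (\<lambda>i. eps i \<omega>) {1..s}" and ?q = "\<lambda>\<omega>. restrict (\<lambda>i. eps i \<omega>) {s<..}"
  have p [measurable]: "?p \<in> measurable M ?P" and q [measurable]: "?q \<in> measurable M ?Q"
    using indep_past_future_restrict[of s] by (auto dest: indep_var_rv1 indep_var_rv2)
  have m: "(\<lambda>(x, y). (F x, G y)) \<in> measurable (?P \<Otimes>\<^sub>M ?Q) (N1 \<Otimes>\<^sub>M N2)"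
    and pq: "(\<lambda>\<omega>. (?p \<omega>, ?q \<omega>)) \<in> measurable M (?P \<Otimes>\<^sub>M ?Q)"
    by measurable
  have "distr M (N1 \<Otimes>\<^sub>M N2) (\<lambda>\<omega>. (F (?p \<omega>), G (?q \<omega>)))
      = distr (distr M (?P \<Otimes>\<^sub>M ?Q) (\<lambda>\<omega>. (?p \<omega>, ?q \<omega>))) (N1 \<Otimes>\<^sub>M N2) (\<lambda>(x, y). (F x, G y))"
    by (simp only: distr_distr[OF m pq] comp_def prod.case)
  also have "distr M (?P \<Otimes>\<^sub>M ?Q) (\<lambda>\<omega>. (?p \<omega>, ?q \<omega>)) = distr M ?P ?p \<Otimes>\<^sub>M distr M ?Q ?q"
    using indep_past_future_restrict[of s] by (simp add: indep_var_distribution_eq)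
  also have "distr \<dots> (N1 \<Otimes>\<^sub>M N2) (\<lambda>(x, y). (F x, G y))
      = distr (distr M ?P ?p) N1 F \<Otimes>\<^sub>M distr (distr M ?Q ?q) N2 G"
  proof (rule pair_measure_distr[symmetric])
    show "sigma_finite_measure (distr (distr M ?Q ?q) N2 G)"
      unfolding distr_distr[OF assms(2) q]
      by (intro prob_space_imp_sigma_finite prob_space_distr measurable_comp[OF q assms(2)])
  qed (use assms in \<open>simp_all only: measurable_distr_eq1\<close>)
  finally show ?thesis
    unfolding distr_distr[OF assms(1) p] distr_distr[OF assms(2) q] comp_def .
qed

lemma indep_X_eps:
  assumes "1 \<le> t"
  shows "indep_var borel (X t) borel (eps (Suc t))"
proof -
  have "indep_var borel (\<lambda>\<omega>. noise_sum 0 t (restrict (\<lambda>i. eps i \<omega>) {1..t}))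
      borel (\<lambda>\<omega>. (\<lambda>e. e (Suc t)) (restrict (\<lambda>i. eps i \<omega>) {t<..}))"
    by (rule indep_past_future) (auto intro!: measurable_noise_sum measurable_component_singleton)
  also have "(\<lambda>\<omega>. noise_sum 0 t (restrict (\<lambda>i. eps i \<omega>) {1..t})) = X t"
    using assms by (subst noise_sum_restrict) (auto simp: X_eq_noise_sum)
  finally show ?thesis
    by simp
qed

text \<open>Induction along the recursion: independent centred normals add their variances, and
  \<open>\<tau>2\<close> says the result is again \<open>\<tau>\<^sup>2\<close>.\<close>

lemma X_distr: "1 \<le> t \<Longrightarrow> distributed M lborel (X t) (normal_density 0 \<tau>)"
proof (induction t rule: dec_induct)
  case base
  show ?case using eps_1 X_1 by (simp add: \<tau>_def)
next
  case (step t)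
  show ?case
  \<comment> \<open>For \<open>a = 0\<close> the summand \<open>a * X t\<close> is constant and has
    no density, so the convolution rule applies only in the other case.\<close>
  proof (cases "a = 0")
    case True
    then have "\<tau> = \<sigma>"
      using \<tau>_def by simp
    with True show ?thesis
      using step eps_distr[of "Suc t"] by (simp add: X_Suc)
  next
    case False
    have "distributed M lborel (\<lambda>\<omega>. 0 + a * X t \<omega>) (normal_density (0 + a * 0) (\<bar>a\<bar> * \<tau>))"
      by (rule normal_density_affine[OF step(3) \<tau>_pos False])
    then have "distributed M lborel (\<lambda>\<omega>. a * X t \<omega>) (normal_density 0 (\<bar>a\<bar> * \<tau>))"
      by simp
    moreover have "indep_var borel ((\<lambda>x. a * x) \<circ> X t) borel (id \<circ> eps (Suc t))"
      by (rule indep_var_compose[OF indep_X_eps]) (use step in auto)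
    ultimately have "distributed M lborel (\<lambda>\<omega>. a * X t \<omega> + eps (Suc t) \<omega>)
        (normal_density (0 + 0) (sqrt ((\<bar>a\<bar> * \<tau>)\<^sup>2 + \<sigma>\<^sup>2)))"
      using step False \<tau>_pos \<sigma>_pos eps_distr[of "Suc t"]
      by (intro add_indep_normal) (auto simp: comp_def)
    moreover have "sqrt ((\<bar>a\<bar> * \<tau>)\<^sup>2 + \<sigma>\<^sup>2) = \<tau>"
      using \<tau>2 \<tau>_pos by (simp add: power_mult_distrib real_sqrt_unique)
    ultimately show ?thesis
      using step by (simp add: X_Suc)
  qed
qed

text \<open>Law of an observation together with the next two noise terms. It does not mention the
  time, and this is the form in which stationarity is used.\<close>

definition triple_law :: "(real \<times> real \<times> real) measure" where
  "triple_law = density lborel (normal_density 0 \<tau>)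
     \<Otimes>\<^sub>M (density lborel (normal_density 0 \<sigma>) \<Otimes>\<^sub>M density lborel (normal_density 0 \<sigma>))"

text \<open>Cutting the noise at \<open>t\<close> separates \<open>X t\<close> from the two later
  terms; cutting at \<open>Suc t\<close> separates those two from each other.\<close>

lemma distr_triple:
  assumes "1 \<le> t"
  shows "distr M (borel \<Otimes>\<^sub>M borel \<Otimes>\<^sub>M borel) (\<lambda>\<omega>. (X t \<omega>, eps (Suc t) \<omega>, eps (Suc (Suc t)) \<omega>)) = triple_law"
proof -
  have F: "noise_sum 0 t \<in> borel_measurable (PiM {1..t} (\<lambda>_. borel))"
    by (rule measurable_noise_sum) auto
  have G: "(\<lambda>e. (e (Suc t), e (Suc (Suc t)))) \<in> measurable (PiM {t<..} (\<lambda>_. borel)) (borel \<Otimes>\<^sub>M borel)"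
    by (auto intro!: measurable_component_singleton measurable_Pair)
  have "(\<lambda>\<omega>. noise_sum 0 t (restrict (\<lambda>i. eps i \<omega>) {1..t})) = X t"
    using assms by (subst noise_sum_restrict) (auto simp: X_eq_noise_sum)
  with distr_past_future[OF F G] have 1: "distr M (borel \<Otimes>\<^sub>M borel \<Otimes>\<^sub>M borel) (\<lambda>\<omega>. (X t \<omega>, eps (Suc t) \<omega>, eps (Suc (Suc t)) \<omega>))
    = distr M borel (X t) \<Otimes>\<^sub>M distr M (borel \<Otimes>\<^sub>M borel) (\<lambda>\<omega>. (eps (Suc t) \<omega>, eps (Suc (Suc t)) \<omega>))"
    by (simp add: fun_eq_iff)
  have "indep_var borel (\<lambda>\<omega>. (\<lambda>e. e (Suc t)) (restrict (\<lambda>i. eps i \<omega>) {1..Suc t}))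
      borel (\<lambda>\<omega>. (\<lambda>e. e (Suc (Suc t))) (restrict (\<lambda>i. eps i \<omega>) {Suc t<..}))"
    by (rule indep_past_future) (auto intro!: measurable_component_singleton)
  then have 2: "indep_var borel (eps (Suc t)) borel (eps (Suc (Suc t)))"
    by simp
  have D: "distributed M lborel Y f \<Longrightarrow> distr M borel Y = density lborel f" for Y f
    by (subst distributed_distr_eq_density[symmetric]) (auto intro: distr_cong)
  have "triple_law = distr M borel (X t) \<Otimes>\<^sub>M (distr M borel (eps (Suc t)) \<Otimes>\<^sub>M distr M borel (eps (Suc (Suc t))))"
    using assms X_distr[of t] eps_distr[of "Suc t"] eps_distr[of "Suc (Suc t)"]
    by (simp add: triple_law_def D)
  then show ?thesis
    using 1 2 by (simp add: indep_var_distribution_eq)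
qed

section \<open>Statistics of three consecutive observations\<close>

definition window :: "(real \<Rightarrow> real \<Rightarrow> real \<Rightarrow> real) \<Rightarrow> nat \<Rightarrow> 'w \<Rightarrow> real" where
  "window g t \<omega> = g (X t \<omega>) (X (Suc t) \<omega>) (X (Suc (Suc t)) \<omega>)"

lemma window_eq: "1 \<le> t \<Longrightarrow> window g t \<omega> = (\<lambda>(x, e, e'). g x (a * x + e) (a * (a * x + e) + e'))
    (X t \<omega>, eps (Suc t) \<omega>, eps (Suc (Suc t)) \<omega>)"
  by (simp add: window_def X_Suc)

lemma window_measurable:
  assumes [measurable]: "(\<lambda>(x, y, z). g x y z) \<in> borel_measurable (borel \<Otimes>\<^sub>M borel \<Otimes>\<^sub>M borel)"
    and t: "1 \<le> t"
  shows "window g t \<in> borel_measurable M"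
proof -
  have [measurable]: "X t \<in> borel_measurable M" "X (Suc t) \<in> borel_measurable M"
    "X (Suc (Suc t)) \<in> borel_measurable M"
    using t by (auto intro!: X_measurable)
  have "(\<lambda>\<omega>. (\<lambda>(x, y, z). g x y z) (X t \<omega>, X (Suc t) \<omega>, X (Suc (Suc t)) \<omega>)) \<in> borel_measurable M"
    by measurable
  then show ?thesis
    by (simp add: window_def[abs_def])
qed

text \<open>The right-hand side is free of \<open>t\<close>, so all windows of the same
  \<open>g\<close> share one mean.\<close>

lemma window_expectation:
  assumes [measurable]: "(\<lambda>(x, y, z). g x y z) \<in> borel_measurable (borel \<Otimes>\<^sub>M borel \<Otimes>\<^sub>M borel)"
    and t: "1 \<le> t"
  shows "expectation (window g t) = (\<integral>(x, e, e'). g x (a * x + e) (a * (a * x + e) + e') \<partial>triple_law)"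
proof -
  have [measurable]: "X t \<in> borel_measurable M"
    "eps (Suc t) \<in> borel_measurable M" "eps (Suc (Suc t)) \<in> borel_measurable M"
    using t by (auto intro!: X_measurable)
  have "(\<lambda>p. (\<lambda>(x, y, z). g x y z) ((\<lambda>(x, e, e'). (x, a * x + e, a * (a * x + e) + e')) p))
      \<in> borel_measurable (borel \<Otimes>\<^sub>M borel \<Otimes>\<^sub>M borel)"
    by measurable
  then have [measurable]: "(\<lambda>(x, e, e'). g x (a * x + e) (a * (a * x + e) + e'))
      \<in> borel_measurable (borel \<Otimes>\<^sub>M borel \<Otimes>\<^sub>M borel)"
    by (simp add: case_prod_beta')
  have "expectation (window g t) = expectation (\<lambda>\<omega>. (\<lambda>(x, e, e'). g x (a * x + e) (a * (a * x + e) + e'))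
    (X t \<omega>, eps (Suc t) \<omega>, eps (Suc (Suc t)) \<omega>))"
    using t by (intro Bochner_Integration.integral_cong) (auto simp: window_eq)
  also have "\<dots> = (\<integral>p. (\<lambda>(x, e, e'). g x (a * x + e) (a * (a * x + e) + e')) p \<partial>triple_law)"
    unfolding distr_triple[OF t, symmetric]
    by (subst integral_distr) measurable
  finally show ?thesis .
qed

section \<open>Moment bounds for statistics of quadratic growth\<close>

definition fourth_moment :: real where
  "fourth_moment = (\<integral>x. normal_density 0 \<tau> x * x ^ 4 \<partial>lborel)"

lemma X_fourth_moment:
  assumes "1 \<le> t"
  shows "integrable M (\<lambda>\<omega>. X t \<omega> ^ 4)" "expectation (\<lambda>\<omega>. X t \<omega> ^ 4) = fourth_moment"
proof -
  note D = X_distr[OF assms]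
  show "integrable M (\<lambda>\<omega>. X t \<omega> ^ 4)"
    using integrable_normal_moment[OF \<tau>_pos, of 0 4]
    by (subst distributed_integrable[OF D, of "\<lambda>x. x ^ 4", symmetric]) auto
  show "expectation (\<lambda>\<omega>. X t \<omega> ^ 4) = fourth_moment"
    unfolding fourth_moment_def
    by (subst distributed_integral[OF D, of "\<lambda>x. x ^ 4", symmetric]) auto
qed

text \<open>The summand 1 keeps it at least 1, so its square absorbs constants as well as quadratic
  growth.\<close>

definition envelope :: "nat \<Rightarrow> 'w \<Rightarrow> real" where
  "envelope t \<omega> = 1 + \<bar>X t \<omega>\<bar> + \<bar>X (Suc t) \<omega>\<bar> + \<bar>X (Suc (Suc t)) \<omega>\<bar>"

lemma envelope_ge_1: "1 \<le> envelope t \<omega>"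
  by (simp add: envelope_def)

lemma envelope_measurable: "1 \<le> t \<Longrightarrow> envelope t \<in> borel_measurable M"
  unfolding envelope_def[abs_def]
  by (intro borel_measurable_add borel_measurable_abs borel_measurable_const X_measurable) auto

lemma envelope_fourth_moment:
  assumes t: "1 \<le> t"
  shows "integrable M (\<lambda>\<omega>. envelope t \<omega> ^ 4)" "expectation (\<lambda>\<omega>. envelope t \<omega> ^ 4) \<le> 64 * (1 + 3 * fourth_moment)"
proof -
  have [measurable]: "envelope t \<in> borel_measurable M"
    by (rule envelope_measurable[OF t])
  have le: "envelope t \<omega> ^ 4 \<le> 64 * (1 + X t \<omega> ^ 4 + X (Suc t) \<omega> ^ 4 + X (Suc (Suc t)) \<omega> ^ 4)" for \<omega>
    using power4_sum4_le[of 1 "\<bar>X t \<omega>\<bar>" "\<bar>X (Suc t) \<omega>\<bar>" "\<bar>X (Suc (Suc t)) \<omega>\<bar>"]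
    by (simp add: envelope_def power_even_abs)
  have i: "integrable M (\<lambda>\<omega>. 64 * (1 + X t \<omega> ^ 4 + X (Suc t) \<omega> ^ 4 + X (Suc (Suc t)) \<omega> ^ 4))"
    using X_fourth_moment t by auto
  show ii: "integrable M (\<lambda>\<omega>. envelope t \<omega> ^ 4)"
    by (rule integrable_if_abs_le[OF i]) (use le in \<open>auto simp: power_even_abs power_abs\<close>)
  have "expectation (\<lambda>\<omega>. envelope t \<omega> ^ 4)
      \<le> expectation (\<lambda>\<omega>. 64 * (1 + X t \<omega> ^ 4 + X (Suc t) \<omega> ^ 4 + X (Suc (Suc t)) \<omega> ^ 4))"
    by (intro integral_mono i ii le)
  also have "\<dots> = 64 * (1 + 3 * fourth_moment)"
    using X_fourth_moment t by (simp add: prob_space)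
  finally show "expectation (\<lambda>\<omega>. envelope t \<omega> ^ 4) \<le> 64 * (1 + 3 * fourth_moment)" .
qed

text \<open>Comparison with the value at the origin. The centre \<open>c\<close> is left free so
  that the bound serves for centred windows.\<close>

lemma quad_lipschitz_growth:
  assumes g: "quad_lipschitz K g"
  shows "\<bar>window g t \<omega> - c\<bar> \<le> (K + \<bar>g 0 0 0 - c\<bar>) * (envelope t \<omega>)\<^sup>2"
proof -
  have "\<bar>window g t \<omega> - g 0 0 0\<bar> \<le> K * envelope t \<omega> * (envelope t \<omega> - 1)"
    using quad_lipschitzD[OF g, of "X t \<omega>" "X (Suc t) \<omega>" "X (Suc (Suc t)) \<omega>" 0 0 0]
    by (simp add: window_def envelope_def add.assoc)
  also have "\<dots> \<le> K * envelope t \<omega> * envelope t \<omega>"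
    using quad_lipschitz_nonneg[OF g] envelope_ge_1[of t \<omega>] by (intro mult_left_mono) auto
  finally have 1: "\<bar>window g t \<omega> - g 0 0 0\<bar> \<le> K * (envelope t \<omega>)\<^sup>2"
    by (simp add: power2_eq_square)
  have "1 \<le> (envelope t \<omega>)\<^sup>2"
    using envelope_ge_1 by simp
  then have 2: "\<bar>g 0 0 0 - c\<bar> * 1 \<le> \<bar>g 0 0 0 - c\<bar> * (envelope t \<omega>)\<^sup>2"
    by (intro mult_left_mono) auto
  show ?thesis
    using 1 2 by (simp add: distrib_right)
qed

text \<open>Each factor is of the order of a squared envelope, and
  \<open>u * v \<le> (u\<^sup>2 + v\<^sup>2) / 2\<close> turns the product into fourth moments,
  which are bounded uniformly in time.\<close>

lemma window_prod_integrable: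
  assumes g: "quad_lipschitz K g" "(\<lambda>(x, y, z). g x y z) \<in> borel_measurable (borel \<Otimes>\<^sub>M borel \<Otimes>\<^sub>M borel)"
    and st: "1 \<le> s" "1 \<le> t"
  shows "integrable M (\<lambda>\<omega>. (window g s \<omega> - c) * (window g t \<omega> - c))"
    and "expectation (\<lambda>\<omega>. (window g s \<omega> - c) * (window g t \<omega> - c))
      \<le> (K + \<bar>g 0 0 0 - c\<bar>)\<^sup>2 * (64 * (1 + 3 * fourth_moment))"
proof -
  define B where "B = K + \<bar>g 0 0 0 - c\<bar>"
  have B: "0 \<le> B"
    using quad_lipschitz_nonneg[OF g(1)] by (simp add: B_def)
  have [measurable]: "window g s \<in> borel_measurable M" "window g t \<in> borel_measurable M"
    using st g(2) by (auto intro!: window_measurable)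
  have le: "\<bar>(window g s \<omega> - c) * (window g t \<omega> - c)\<bar> \<le> B\<^sup>2 * ((envelope s \<omega> ^ 4 + envelope t \<omega> ^ 4) / 2)" for \<omega>
  proof -
    have "\<bar>(window g s \<omega> - c) * (window g t \<omega> - c)\<bar> \<le> (B * (envelope s \<omega>)\<^sup>2) * (B * (envelope t \<omega>)\<^sup>2)"
      unfolding abs_mult B_def using B
      by (intro mult_mono quad_lipschitz_growth g) (auto simp: B_def)
    also have "\<dots> = B\<^sup>2 * ((envelope s \<omega>)\<^sup>2 * (envelope t \<omega>)\<^sup>2)"
      by (simp add: power2_eq_square)
    also have "\<dots> \<le> B\<^sup>2 * ((envelope s \<omega> ^ 4 + envelope t \<omega> ^ 4) / 2)"
      using sum_squares_bound[of "(envelope s \<omega>)\<^sup>2" "(envelope t \<omega>)\<^sup>2"] by (intro mult_left_mono) auto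
    finally show ?thesis .
  qed
  have i: "integrable M (\<lambda>\<omega>. B\<^sup>2 * ((envelope s \<omega> ^ 4 + envelope t \<omega> ^ 4) / 2))"
    using envelope_fourth_moment st by auto
  show ii: "integrable M (\<lambda>\<omega>. (window g s \<omega> - c) * (window g t \<omega> - c))"
    by (rule integrable_if_abs_le[OF i _ le]) measurable
  have "expectation (\<lambda>\<omega>. (window g s \<omega> - c) * (window g t \<omega> - c)) \<le> expectation (\<lambda>\<omega>. B\<^sup>2 * ((envelope s \<omega> ^ 4 + envelope t \<omega> ^ 4) / 2))"
    by (rule integral_mono[OF ii i order_trans[OF abs_ge_self le]])
  also have "\<dots> = B\<^sup>2 * ((expectation (\<lambda>\<omega>. envelope s \<omega> ^ 4) + expectation (\<lambda>\<omega>. envelope t \<omega> ^ 4)) / 2)"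
    using envelope_fourth_moment st by simp
  also have "\<dots> \<le> B\<^sup>2 * (64 * (1 + 3 * fourth_moment))"
    using envelope_fourth_moment(2)[of s] envelope_fourth_moment(2)[of t] st by (intro mult_left_mono) auto
  finally show "expectation (\<lambda>\<omega>. (window g s \<omega> - c) * (window g t \<omega> - c))
      \<le> (K + \<bar>g 0 0 0 - c\<bar>)\<^sup>2 * (64 * (1 + 3 * fourth_moment))"
    by (simp add: B_def)
qed

lemma window_integrable:
  assumes g: "quad_lipschitz K g" "(\<lambda>(x, y, z). g x y z) \<in> borel_measurable (borel \<Otimes>\<^sub>M borel \<Otimes>\<^sub>M borel)"
    and t: "1 \<le> t"
  shows "integrable M (window g t)"
proof (rule square_integrable_imp_integrable)
  show "window g t \<in> borel_measurable M"
    using g t by (intro window_measurable)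
  show "integrable M (\<lambda>\<omega>. (window g t \<omega>)\<^sup>2)"
    using window_prod_integrable(1)[OF g t t, of 0] by (simp add: power2_eq_square)
qed

text \<open>Restarting the process from 0 at time \<open>s + 2\<close> makes the later triple independent
  of the earlier one, at the price of an error of order \<open>\<bar>a\<bar> ^ (t - s - 2)\<close>.\<close>
lemma window_covariance_decay:
  assumes g: "quad_lipschitz K g" "(\<lambda>(x, y, z). g x y z) \<in> borel_measurable (borel \<Otimes>\<^sub>M borel \<Otimes>\<^sub>M borel)"
    and st: "1 \<le> s" "Suc (Suc s) \<le> t"
    and \<mu>: "expectation (window g s) = \<mu>"
  shows "expectation (\<lambda>\<omega>. (window g s \<omega> - \<mu>) * (window g t \<omega> - \<mu>))
    \<le> 36 * K * (K + \<bar>g 0 0 0 - \<mu>\<bar>) * (64 * (1 + 3 * fourth_moment)) * \<bar>a\<bar> ^ (t - Suc (Suc s))"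
proof -
  define B where "B = K + \<bar>g 0 0 0 - \<mu>\<bar>"
  have K0: "0 \<le> K"
    by (rule quad_lipschitz_nonneg[OF g(1)])
  then have B: "0 \<le> B"
    by (simp add: B_def)
  \<comment> \<open>The last time seen by the window at \<open>s\<close>: \<open>F\<close> below
    uses only noise up to \<open>r\<close>, \<open>G\<close> only noise after it.\<close>
  define r where "r = Suc (Suc s)"
  define m where "m = t - r"
  define F where "F e = g (noise_sum 0 s e) (noise_sum 0 (Suc s) e) (noise_sum 0 r e)" for e
  define G where "G e = g (noise_sum r t e) (noise_sum r (Suc t) e) (noise_sum r (Suc (Suc t)) e)" for e
  define V' where "V' \<omega> = G (\<lambda>i. eps i \<omega>)" for \<omega>
  have t: "t = r + m" "1 \<le> t" "1 \<le> r"
    using st by (auto simp: m_def r_def)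
  have [measurable]: "window g s \<in> borel_measurable M" "window g t \<in> borel_measurable M"
    using st g(2) t by (auto intro!: window_measurable)
  have Fm: "F \<in> borel_measurable (PiM {1..r} (\<lambda>_. borel))"
  proof -
    have "(\<lambda>e. (\<lambda>(x, y, z). g x y z) (noise_sum 0 s e, noise_sum 0 (Suc s) e, noise_sum 0 r e))
        \<in> borel_measurable (PiM {1..r} (\<lambda>_. borel))"
      by (rule measurable_compose[OF _ g(2)])
         (auto intro!: measurable_Pair measurable_noise_sum simp: r_def)
    then show ?thesis by (simp add: F_def[abs_def])
  qed
  have Gm: "G \<in> borel_measurable (PiM {r<..} (\<lambda>_. borel))"
  proof -
    have "(\<lambda>e. (\<lambda>(x, y, z). g x y z) (noise_sum r t e, noise_sum r (Suc t) e, noise_sum r (Suc (Suc t)) e))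
        \<in> borel_measurable (PiM {r<..} (\<lambda>_. borel))"
      by (rule measurable_compose[OF _ g(2)])
         (auto intro!: measurable_Pair measurable_noise_sum)
    then show ?thesis by (simp add: G_def[abs_def])
  qed
  have "indep_var borel (\<lambda>\<omega>. F (restrict (\<lambda>i. eps i \<omega>) {1..r})) borel (\<lambda>\<omega>. G (restrict (\<lambda>i. eps i \<omega>) {r<..}))"
    by (rule indep_past_future[OF Fm Gm])
  also have "(\<lambda>\<omega>. F (restrict (\<lambda>i. eps i \<omega>) {1..r})) = window g s"
  proof
    fix \<omega>
    show "F (restrict (\<lambda>i. eps i \<omega>) {1..r}) = window g s \<omega>"
      unfolding F_def window_def using st
      by (subst (1 2 3) noise_sum_restrict) (auto simp: X_eq_noise_sum r_def)
  qed
  also have "(\<lambda>\<omega>. G (restrict (\<lambda>i. eps i \<omega>) {r<..})) = V'"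
  proof
    fix \<omega>
    show "G (restrict (\<lambda>i. eps i \<omega>) {r<..}) = V' \<omega>"
      unfolding G_def V'_def by (subst (1 2 3) noise_sum_restrict) auto
  qed
  finally have indep: "indep_var borel (window g s) borel V'" .
  then have [measurable]: "V' \<in> borel_measurable M"
    by (rule indep_var_rv2)
  \<comment> \<open>Restarting changes each coordinate by at most
    \<open>\<bar>a\<bar> ^ m * \<bar>X r \<omega>\<bar>\<close>. As \<open>X r\<close> is the third
    coordinate of the earlier window, \<open>envelope s\<close> controls it. The 9 is 3 from the
    growth factor times 3 coordinates.\<close>
  have diff: "\<bar>window g t \<omega> - V' \<omega>\<bar> \<le> K * 9 * \<bar>a\<bar> ^ m * (2 * ((envelope s \<omega>)\<^sup>2 + (envelope t \<omega>)\<^sup>2))" for \<omega>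
  proof -
    define T where "T = \<bar>X r \<omega>\<bar>"
    have T: "0 \<le> T" by (simp add: T_def)
    have n: "noise_sum r (t + j) (\<lambda>i. eps i \<omega>) = X (t + j) \<omega> - a ^ (m + j) * X r \<omega>" for j
      using X_shift[OF t(3), of "m + j" \<omega>] by (simp add: t(1) add.assoc)
    have p: "\<bar>a ^ (m + j) * X r \<omega>\<bar> \<le> \<bar>a\<bar> ^ m * T" for j
    proof -
      have "\<bar>a\<bar> ^ (m + j) \<le> \<bar>a\<bar> ^ m"
        using a_bound by (intro power_decreasing) auto
      then show ?thesis
        by (auto simp: abs_mult power_abs T_def intro!: mult_right_mono)
    qed
    have q: "\<bar>a\<bar> ^ m * T \<le> T"
      using a_bound T by (intro mult_left_le_one_le) (auto intro: power_le_one)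
    define x y z where "x = X t \<omega>" "y = X (Suc t) \<omega>" "z = X (Suc (Suc t)) \<omega>"
    define x' y' z' where "x' = noise_sum r t (\<lambda>i. eps i \<omega>)" "y' = noise_sum r (Suc t) (\<lambda>i. eps i \<omega>)"
      "z' = noise_sum r (Suc (Suc t)) (\<lambda>i. eps i \<omega>)"
    have d: "\<bar>x - x'\<bar> \<le> \<bar>a\<bar> ^ m * T" "\<bar>y - y'\<bar> \<le> \<bar>a\<bar> ^ m * T" "\<bar>z - z'\<bar> \<le> \<bar>a\<bar> ^ m * T"
      using p[of 0] p[of 1] p[of 2] n[of 0] n[of 1] n[of 2]
      by (auto simp: x_y_z_def x'_y'_z'_def)
    have "\<bar>window g t \<omega> - V' \<omega>\<bar> = \<bar>g x y z - g x' y' z'\<bar>"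
      by (simp add: window_def V'_def G_def x_y_z_def x'_y'_z'_def)
    also have "\<dots> \<le> K * (1 + \<bar>x\<bar> + \<bar>y\<bar> + \<bar>z\<bar> + \<bar>x'\<bar> + \<bar>y'\<bar> + \<bar>z'\<bar>) * (\<bar>x - x'\<bar> + \<bar>y - y'\<bar> + \<bar>z - z'\<bar>)"
      by (rule quad_lipschitzD[OF g(1)])
    also have "\<dots> \<le> K * (3 * (envelope s \<omega> + envelope t \<omega>)) * (3 * (\<bar>a\<bar> ^ m * (envelope s \<omega> + envelope t \<omega>)))"
    proof (intro mult_mono mult_left_mono K0)
      have Ns: "T + 1 \<le> envelope s \<omega>"
        by (simp add: envelope_def T_def r_def)
      show "1 + \<bar>x\<bar> + \<bar>y\<bar> + \<bar>z\<bar> + \<bar>x'\<bar> + \<bar>y'\<bar> + \<bar>z'\<bar> \<le> 3 * (envelope s \<omega> + envelope t \<omega>)"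
      proof -
        have "\<bar>x'\<bar> \<le> \<bar>x\<bar> + T" "\<bar>y'\<bar> \<le> \<bar>y\<bar> + T" "\<bar>z'\<bar> \<le> \<bar>z\<bar> + T"
          using d q by linarith+
        moreover have "envelope t \<omega> = 1 + \<bar>x\<bar> + \<bar>y\<bar> + \<bar>z\<bar>"
          by (simp add: envelope_def x_y_z_def)
        ultimately show ?thesis
          using Ns envelope_ge_1[of t \<omega>] by (smt (verit))
      qed
      have "\<bar>a\<bar> ^ m * T \<le> \<bar>a\<bar> ^ m * (envelope s \<omega> + envelope t \<omega>)"
        using Ns envelope_ge_1[of t \<omega>] by (intro mult_left_mono) auto
      then show "\<bar>x - x'\<bar> + \<bar>y - y'\<bar> + \<bar>z - z'\<bar> \<le> 3 * (\<bar>a\<bar> ^ m * (envelope s \<omega> + envelope t \<omega>))"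
        using d by linarith
    qed (use K0 envelope_ge_1[of s \<omega>] envelope_ge_1[of t \<omega>] in auto)
    also have "\<dots> = K * 9 * \<bar>a\<bar> ^ m * (envelope s \<omega> + envelope t \<omega>)\<^sup>2"
      by (simp add: power2_eq_square algebra_simps)
    also have "\<dots> \<le> K * 9 * \<bar>a\<bar> ^ m * (2 * ((envelope s \<omega>)\<^sup>2 + (envelope t \<omega>)\<^sup>2))"
      using K0 sum_squares_bound[of "envelope s \<omega>" "envelope t \<omega>"]
      by (intro mult_left_mono) (auto simp: power2_sum)
    finally show ?thesis .
  qed
  have int_s: "integrable M (window g s)" and int_t: "integrable M (window g t)"
    using g st t by (auto intro!: window_integrable)
  have sq_int: "integrable M (\<lambda>\<omega>. (envelope t \<omega>)\<^sup>2)" if "1 \<le> t" for t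
    using envelope_measurable[OF that] envelope_fourth_moment(1)[OF that]
    by - (rule square_integrable_imp_integrable, auto)
  \<comment> \<open>The restarted window is not a window of the stationary process, so its
    integrability is obtained from that of the difference.\<close>
  have int_d: "integrable M (\<lambda>\<omega>. window g t \<omega> - V' \<omega>)"
  proof (rule integrable_if_abs_le[OF _ _ diff])
    show "integrable M (\<lambda>\<omega>. K * 9 * \<bar>a\<bar> ^ m * (2 * ((envelope s \<omega>)\<^sup>2 + (envelope t \<omega>)\<^sup>2)))"
      using sq_int st t by auto
  qed measurable
  have int_V': "integrable M V'"
    using Bochner_Integration.integrable_diff[OF int_t int_d] by simp
  have "indep_var borel ((\<lambda>x. x - \<mu>) \<circ> window g s) borel ((\<lambda>x. x - \<mu>) \<circ> V')"
    by (rule indep_var_compose[OF indep]) auto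
  then have ind': "indep_var borel (\<lambda>\<omega>. window g s \<omega> - \<mu>) borel (\<lambda>\<omega>. V' \<omega> - \<mu>)"
    by (simp add: comp_def)
  \<comment> \<open>By independence the mean factorises, and the first factor is centred; the mean
    of \<open>V'\<close> may differ from \<open>\<mu>\<close>.\<close>
  have zero: "expectation (\<lambda>\<omega>. (window g s \<omega> - \<mu>) * (V' \<omega> - \<mu>)) = 0"
    using indep_var_lebesgue_integral[OF ind'] int_s int_V' \<mu> by (simp add: prob_space)
  have int_0: "integrable M (\<lambda>\<omega>. (window g s \<omega> - \<mu>) * (V' \<omega> - \<mu>))"
    using indep_var_integrable[OF ind'] int_s int_V' by simp
  have le: "(window g s \<omega> - \<mu>) * (window g t \<omega> - V' \<omega>)
      \<le> B * (K * 9 * \<bar>a\<bar> ^ m) * (3 * envelope s \<omega> ^ 4 + envelope t \<omega> ^ 4)" (is "_ \<le> ?R \<omega>") for \<omega>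
  proof -
    have "(window g s \<omega> - \<mu>) * (window g t \<omega> - V' \<omega>) \<le> \<bar>window g s \<omega> - \<mu>\<bar> * \<bar>window g t \<omega> - V' \<omega>\<bar>"
      by (metis abs_ge_self abs_mult)
    also have "\<dots> \<le> (B * (envelope s \<omega>)\<^sup>2) * (K * 9 * \<bar>a\<bar> ^ m * (2 * ((envelope s \<omega>)\<^sup>2 + (envelope t \<omega>)\<^sup>2)))"
      unfolding B_def using B K0
      by (intro mult_mono quad_lipschitz_growth diff g) (auto simp: B_def)
    also have "\<dots> = B * (K * 9 * \<bar>a\<bar> ^ m) * (2 * ((envelope s \<omega>)\<^sup>2 * (envelope s \<omega>)\<^sup>2) + 2 * (envelope s \<omega>)\<^sup>2 * (envelope t \<omega>)\<^sup>2)"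
      by (simp add: algebra_simps)
    also have "\<dots> \<le> ?R \<omega>"
      using B K0 sum_squares_bound[of "(envelope s \<omega>)\<^sup>2" "(envelope t \<omega>)\<^sup>2"]
      by (intro mult_left_mono) (auto simp flip: power_add)
    finally show ?thesis .
  qed
  have intp: "integrable M (\<lambda>\<omega>. (window g s \<omega> - \<mu>) * (window g t \<omega> - \<mu>))"
    by (rule window_prod_integrable(1)[OF g]) (use st t in auto)
  have int_1: "integrable M (\<lambda>\<omega>. (window g s \<omega> - \<mu>) * (window g t \<omega> - V' \<omega>))"
    using Bochner_Integration.integrable_diff[OF intp int_0]
    by (simp add: algebra_simps)
  have int_R: "integrable M ?R"
    using envelope_fourth_moment(1) st t by auto
  have "expectation (\<lambda>\<omega>. (window g s \<omega> - \<mu>) * (window g t \<omega> - \<mu>))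
      = expectation (\<lambda>\<omega>. (window g s \<omega> - \<mu>) * (V' \<omega> - \<mu>) + (window g s \<omega> - \<mu>) * (window g t \<omega> - V' \<omega>))"
    by (intro Bochner_Integration.integral_cong) (auto simp: algebra_simps)
  also have "\<dots> = expectation (\<lambda>\<omega>. (window g s \<omega> - \<mu>) * (window g t \<omega> - V' \<omega>))"
    using int_0 int_1 zero by simp
  also have "\<dots> \<le> expectation ?R"
    by (intro integral_mono int_1 int_R le)
  also have "\<dots> = B * (K * 9 * \<bar>a\<bar> ^ m) * (3 * expectation (\<lambda>\<omega>. envelope s \<omega> ^ 4) + expectation (\<lambda>\<omega>. envelope t \<omega> ^ 4))"
    using envelope_fourth_moment(1) st t by simp
  \<comment> \<open>Three fourth moments at \<open>s\<close> and one at \<open>t\<close> give the 4,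
    hence \<open>36 = 9 * 4\<close> in the statement.\<close>
  also have "\<dots> \<le> B * (K * 9 * \<bar>a\<bar> ^ m) * (4 * (64 * (1 + 3 * fourth_moment)))"
    using envelope_fourth_moment(2)[of s] envelope_fourth_moment(2)[of t] st t B K0
    by (intro mult_left_mono) auto
  finally show ?thesis
    by (simp add: B_def m_def r_def algebra_simps)
qed

text \<open>Sampling along \<open>c * k + d\<close> covers both uses: step 1 for the sums in the
  estimates, step 2 for the bets, which are placed at every other time.\<close>

lemma window_slln:
  assumes g: "quad_lipschitz K g" "(\<lambda>(x, y, z). g x y z) \<in> borel_measurable (borel \<Otimes>\<^sub>M borel \<Otimes>\<^sub>M borel)"
    and cd: "1 \<le> c" "1 \<le> d"
  shows "AE \<omega> in M. (\<lambda>n. (\<Sum>k<n. window g (c * k + d) \<omega>) / real n) \<longlonglongrightarrow> expectation (window g 2)"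
proof -
  define \<mu> where "\<mu> = expectation (window g 2)"
  have \<mu>: "expectation (window g t) = \<mu>" if "1 \<le> t" for t
    using that window_expectation[OF g(2)] by (simp add: \<mu>_def)
  define B where "B = K + \<bar>g 0 0 0 - \<mu>\<bar>"
  define Q where "Q = 64 * (1 + 3 * fourth_moment)"
  have K0: "0 \<le> K" by (rule quad_lipschitz_nonneg[OF g(1)])
  have B0: "0 \<le> B" using K0 by (simp add: B_def)
  have "0 \<le> fourth_moment"
    unfolding fourth_moment_def by (intro Bochner_Integration.integral_nonneg) auto
  then have Q0: "0 \<le> Q" by (simp add: Q_def)
  \<comment> \<open>A rate that stays above \<open>1 / 2\<close>, also for \<open>a = 0\<close>. The
    factor 4 in \<open>decay\<close> then pays both for the exponent lost by restarting two steps
    later and for gaps 0 and 1, where the windows overlap too much for the restart argument.\<close>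
  define \<rho> where "\<rho> = (1 + \<bar>a\<bar>) / 2"
  have \<rho>: "1 / 2 \<le> \<rho>" "\<rho> < 1" "\<bar>a\<bar> \<le> \<rho>"
    using a_bound by (auto simp: \<rho>_def)
  define C where "C = 36 * K * B * Q + B\<^sup>2 * Q"
  have C0: "0 \<le> C" using K0 B0 Q0 by (simp add: C_def)
  have decay: "expectation (\<lambda>\<omega>. (window g s \<omega> - \<mu>) * (window g t \<omega> - \<mu>)) \<le> 4 * C * \<rho> ^ (t - s)"
    if st: "1 \<le> s" "s \<le> t" for s t
  proof (cases "Suc (Suc s) \<le> t")
    case True
    define m where "m = t - Suc (Suc s)"
    have ts: "t - s = m + 2" using True by (simp add: m_def)
    have "expectation (\<lambda>\<omega>. (window g s \<omega> - \<mu>) * (window g t \<omega> - \<mu>)) \<le> 36 * K * B * Q * \<bar>a\<bar> ^ m"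
      unfolding B_def Q_def m_def by (rule window_covariance_decay[OF g st(1) True \<mu>[OF st(1)]])
    also have "\<dots> \<le> C * \<rho> ^ m"
      using \<rho> K0 B0 Q0 by (intro mult_mono power_mono) (auto simp: C_def)
    also have "\<dots> \<le> C * \<rho> ^ m * (4 * \<rho>\<^sup>2)"
    proof -
      have "(1 / 2)\<^sup>2 \<le> \<rho>\<^sup>2" using \<rho> by (intro power_mono) auto
      then have "1 \<le> 4 * \<rho>\<^sup>2" by (simp add: power2_eq_square)
      then have "C * \<rho> ^ m * 1 \<le> C * \<rho> ^ m * (4 * \<rho>\<^sup>2)"
        using C0 \<rho> by (intro mult_left_mono) auto
      then show ?thesis by simp
    qed
    also have "\<dots> = 4 * C * \<rho> ^ (t - s)"
      unfolding ts by (simp add: power_add power2_eq_square)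
    finally show ?thesis .
  next
    case False
    then have "\<rho> ^ 1 \<le> \<rho> ^ (t - s)"
      using \<rho> by (intro power_decreasing) auto
    then have *: "1 \<le> 4 * \<rho> ^ (t - s)" using \<rho> by simp
    have "expectation (\<lambda>\<omega>. (window g s \<omega> - \<mu>) * (window g t \<omega> - \<mu>)) \<le> B\<^sup>2 * Q"
      unfolding B_def Q_def using st by (intro window_prod_integrable(2) g) auto
    also have "\<dots> \<le> C * 1"
      using K0 B0 Q0 by (simp add: C_def)
    also have "\<dots> \<le> C * (4 * \<rho> ^ (t - s))"
      using C0 * by (intro mult_left_mono) auto
    finally show ?thesis by simp
  qed
  have "AE \<omega> in M. (\<lambda>n. (\<Sum>k<n. window g (c * k + d) \<omega> - \<mu>) / real n) \<longlonglongrightarrow> 0"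
  proof (rule slln_of_correlation_decay[where \<rho> = \<rho> and C = "4 * C"])
    show "(\<lambda>\<omega>. window g (c * k + d) \<omega> - \<mu>) \<in> borel_measurable M" for k
      using cd by (intro borel_measurable_diff window_measurable g borel_measurable_const) auto
    show "integrable M (\<lambda>\<omega>. (window g (c * i + d) \<omega> - \<mu>) * (window g (c * j + d) \<omega> - \<mu>))" for i j
      using cd by (intro window_prod_integrable(1)[OF g]) auto
    show "0 \<le> \<rho>" "\<rho> < 1" using \<rho> by auto
    fix i j :: nat
    assume ij: "i \<le> j"
    have "expectation (\<lambda>\<omega>. (window g (c * i + d) \<omega> - \<mu>) * (window g (c * j + d) \<omega> - \<mu>))
        \<le> 4 * C * \<rho> ^ ((c * j + d) - (c * i + d))"
      using cd ij by (intro decay) auto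
    also have "\<dots> \<le> 4 * C * \<rho> ^ (j - i)"
    proof (intro mult_left_mono power_decreasing)
      have "1 * (j - i) \<le> c * (j - i)"
        using cd by (intro mult_right_mono) auto
      then show "j - i \<le> c * j + d - (c * i + d)"
        by (simp add: diff_mult_distrib2)
    qed (use \<rho> C0 in auto)
    finally show "expectation (\<lambda>\<omega>. (window g (c * i + d) \<omega> - \<mu>) * (window g (c * j + d) \<omega> - \<mu>)) \<le> 4 * C * \<rho> ^ (j - i)" .
  qed
  then show ?thesis
  proof eventually_elim
    case (elim \<omega>)
    have "(\<lambda>n. (\<Sum>k<n. window g (c * k + d) \<omega> - \<mu>) / real n + \<mu>) \<longlonglongrightarrow> 0 + \<mu>"
      by (intro tendsto_add elim tendsto_const)
    moreover have "\<forall>\<^sub>F n in sequentially. (\<Sum>k<n. window g (c * k + d) \<omega> - \<mu>) / real n + \<mu>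
        = (\<Sum>k<n. window g (c * k + d) \<omega>) / real n"
      using eventually_gt_at_top[of 0]
      by eventually_elim (simp add: sum_subtractf field_simps)
    ultimately show ?case
      using Lim_transform_eventually unfolding \<mu>_def by fastforce
  qed
qed

end

section \<open>Scores, estimates and wealth\<close>

lemma quad_lipschitz_const: "quad_lipschitz 0 (\<lambda>x y z. c)"
  by (simp add: quad_lipschitz_def)

lemma quad_lipschitz_add:
  assumes "quad_lipschitz K g" "quad_lipschitz L h"
  shows "quad_lipschitz (K + L) (\<lambda>x y z. g x y z + h x y z)"
  unfolding quad_lipschitz_def distrib_right
proof (intro allI)
  fix x y z x' y' z'
  show "\<bar>g x y z + h x y z - (g x' y' z' + h x' y' z')\<bar>
     \<le> K * (1 + \<bar>x\<bar> + \<bar>y\<bar> + \<bar>z\<bar> + \<bar>x'\<bar> + \<bar>y'\<bar> + \<bar>z'\<bar>) * (\<bar>x - x'\<bar> + \<bar>y - y'\<bar> + \<bar>z - z'\<bar>)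
     + L * (1 + \<bar>x\<bar> + \<bar>y\<bar> + \<bar>z\<bar> + \<bar>x'\<bar> + \<bar>y'\<bar> + \<bar>z'\<bar>) * (\<bar>x - x'\<bar> + \<bar>y - y'\<bar> + \<bar>z - z'\<bar>)"
    using quad_lipschitzD[OF assms(1), of x y z x' y' z'] quad_lipschitzD[OF assms(2), of x y z x' y' z']
      abs_triangle_ineq[of "g x y z - g x' y' z'" "h x y z - h x' y' z'"]
    by (simp add: algebra_simps)
qed

lemma quad_lipschitz_compose_lipschitz:
  assumes "quad_lipschitz K g" and f: "\<And>u v. \<bar>f u - f v\<bar> \<le> C * \<bar>u - v\<bar>"
  shows "quad_lipschitz (C * K) (\<lambda>x y z. f (g x y z))"
  unfolding quad_lipschitz_def
proof (intro allI)
  fix x y z x' y' z'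
  have "0 \<le> C" using f[of 0 1] by simp
  then show "\<bar>f (g x y z) - f (g x' y' z')\<bar>
     \<le> C * K * (1 + \<bar>x\<bar> + \<bar>y\<bar> + \<bar>z\<bar> + \<bar>x'\<bar> + \<bar>y'\<bar> + \<bar>z'\<bar>) * (\<bar>x - x'\<bar> + \<bar>y - y'\<bar> + \<bar>z - z'\<bar>)"
    using order_trans[OF f mult_left_mono[OF quad_lipschitzD[OF assms(1)]], of x y z x' y' z']
    by (simp add: mult.assoc)
qed

lemma quad_lipschitz_cmult:
  assumes "quad_lipschitz K g"
  shows "quad_lipschitz (\<bar>c\<bar> * K) (\<lambda>x y z. c * g x y z)"
  by (rule quad_lipschitz_compose_lipschitz[OF assms, where f = "\<lambda>u. c * u"])
     (simp add: abs_mult flip: right_diff_distrib)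

text \<open>Product rule \<open>u * v - u' * v' = u * (v - v') + v' * (u - u')\<close>. The factor 1
  in the conclusion is the constant of \<open>quad_lipschitz 1\<close>, so that the rule matches the
  unfolded goals for monomials.\<close>

lemma abs_mult_diff_le:
  fixes u v u' v' :: real
  assumes "\<bar>u - u'\<bar> \<le> d" "\<bar>v - v'\<bar> \<le> d" "\<bar>u\<bar> + \<bar>v'\<bar> \<le> s"
  shows "\<bar>u * v - u' * v'\<bar> \<le> 1 * s * d"
proof -
  have "u * v - u' * v' = u * (v - v') + v' * (u - u')"
    by (simp add: algebra_simps)
  then have "\<bar>u * v - u' * v'\<bar> \<le> \<bar>u\<bar> * \<bar>v - v'\<bar> + \<bar>v'\<bar> * \<bar>u - u'\<bar>"
    by (metis abs_mult abs_triangle_ineq)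
  also have "\<dots> \<le> \<bar>u\<bar> * d + \<bar>v'\<bar> * d"
    using assms by (intro add_mono mult_left_mono) auto
  also have "\<dots> = (\<bar>u\<bar> + \<bar>v'\<bar>) * d"
    by (simp add: distrib_right)
  also have "\<dots> \<le> s * d"
    using assms by (intro mult_right_mono) auto
  finally show ?thesis by simp
qed

lemma quad_lipschitz_monomials:
  "quad_lipschitz 1 (\<lambda>x y z. x * x)" "quad_lipschitz 1 (\<lambda>x y z. y * y)" "quad_lipschitz 1 (\<lambda>x y z. z * z)"
  "quad_lipschitz 1 (\<lambda>x y z. x * y)" "quad_lipschitz 1 (\<lambda>x y z. x * z)"
  unfolding quad_lipschitz_def by (intro allI abs_mult_diff_le; simp)+

text \<open>The logarithm of \<open>ar_f a s2 x y z / ar_f a s2 x z y\<close> after expanding the squares.\<close>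
definition log_ratio :: "real \<Rightarrow> real \<Rightarrow> real \<Rightarrow> real \<Rightarrow> real \<Rightarrow> real" where
  "log_ratio a s2 x y z = a\<^sup>2 / (2 * s2) * (z * z - y * y) - a / s2 * (x * z - x * y)"

text \<open>Logarithm of \<open>2 / (1 + exp (- d))\<close>, the score as a function of the log
  likelihood ratio of the two orderings.\<close>

definition log_betting :: "real \<Rightarrow> real" where
  "log_betting d = ln 2 - ln (1 + exp (- d))"

lemma ar_f_pos: "0 < s2 \<Longrightarrow> 0 < ar_f a s2 x y z"
  by (simp add: ar_f_def)

lemma ar_f_swap:
  assumes "0 < s2"
  shows "ar_f a s2 x z y = ar_f a s2 x y z * exp (- log_ratio a s2 x y z)"
proof -
  have *: "- (z - a * x)\<^sup>2 / (2 * s2) - (y - a * z)\<^sup>2 / (2 * s2)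
      = - (y - a * x)\<^sup>2 / (2 * s2) - (z - a * y)\<^sup>2 / (2 * s2) + - log_ratio a s2 x y z"
    using assms by (simp add: log_ratio_def field_simps power2_eq_square)
  show ?thesis
    unfolding ar_f_def mult.assoc exp_add[symmetric]
    by (rule arg_cong[OF *, where f = "\<lambda>u. 1 / (2 * (pi * s2)) * exp u"])
qed

lemma pair_score_ar_f:
  assumes "0 < s2"
  shows "pair_score (ar_f a s2) x y z = 2 / (1 + exp (- log_ratio a s2 x y z))"
proof -
  have "pair_score (ar_f a s2) x y z
      = 2 * ar_f a s2 x y z / (ar_f a s2 x y z * (1 + exp (- log_ratio a s2 x y z)))"
    unfolding pair_score_def ar_f_swap[OF assms, where x = x and y = y and z = z] by (simp add: distrib_left)
  then show ?thesis
    using ar_f_pos[OF assms, of a x y z] by simp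
qed

lemma pair_score_ar_f_pos: "0 < s2 \<Longrightarrow> 0 < pair_score (ar_f a s2) x y z"
  by (simp add: pair_score_ar_f add_pos_pos)

lemma ln_pair_score_ar_f:
  assumes "0 < s2"
  shows "ln (pair_score (ar_f a s2) x y z) = log_betting (log_ratio a s2 x y z)"
proof -
  have "0 < 1 + exp (- log_ratio a s2 x y z)"
    by (simp add: add_pos_pos)
  then show ?thesis
    by (simp add: pair_score_ar_f[OF assms] log_betting_def ln_div)
qed

text \<open>The derivative is \<open>1 / (1 + exp d)\<close>, between 0 and 1. Instead of
  differentiating, the proof compares \<open>1 + exp (- u)\<close> with
  \<open>exp (v - u) * (1 + exp (- v))\<close> for \<open>u \<le> v\<close>.\<close>

lemma log_betting_lipschitz: "\<bar>log_betting u - log_betting v\<bar> \<le> 1 * \<bar>u - v\<bar>"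
proof -
  have *: "0 \<le> log_betting v - log_betting u \<and> log_betting v - log_betting u \<le> v - u" if "u \<le> v" for u v
  proof
    have pos: "0 < 1 + exp (- w)" for w :: real
      by (simp add: add_pos_pos)
    show "0 \<le> log_betting v - log_betting u"
      using that pos by (simp add: log_betting_def)
    have "ln (1 + exp (- u)) \<le> ln (exp (v - u) * (1 + exp (- v)))"
    proof (subst ln_le_cancel_iff)
      have "1 \<le> exp (v - u)" using that by simp
      then show "1 + exp (- u) \<le> exp (v - u) * (1 + exp (- v))"
        by (simp add: distrib_left flip: exp_add)
    qed (use pos in auto)
    also have "\<dots> = v - u + ln (1 + exp (- v))"
      using pos[of v] by (subst ln_mult_pos) auto
    finally show "log_betting v - log_betting u \<le> v - u"
      by (simp add: log_betting_def)
  qed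
  show ?thesis
    using *[of u v] *[of v u] by (cases "u \<le> v") auto
qed

text \<open>This is \<open>ln u \<le> u - 1\<close> at \<open>u = (1 + exp (- d)) / 2\<close>, with
  equality only at \<open>u = 1\<close>.\<close>

lemma log_betting_ge: "(1 - exp (- d)) / 2 \<le> log_betting d"
  and log_betting_eq_imp: "log_betting d = (1 - exp (- d)) / 2 \<Longrightarrow> d = 0"
proof -
  have pos: "0 < (1 + exp (- d)) / 2"
    by (simp add: add_pos_pos)
  have eq: "log_betting d = - ln ((1 + exp (- d)) / 2)"
    using pos by (simp add: log_betting_def ln_div)
  show "(1 - exp (- d)) / 2 \<le> log_betting d"
    using ln_le_minus_one[OF pos] by (simp add: eq field_simps)
  assume "log_betting d = (1 - exp (- d)) / 2"
  then have "ln ((1 + exp (- d)) / 2) = (1 + exp (- d)) / 2 - 1"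
    by (simp add: eq field_simps)
  from ln_eq_minus_one[OF pos this] show "d = 0"
    by simp
qed

lemma quad_lipschitz_log_ratio: "\<exists>K. quad_lipschitz K (log_ratio a s2)"
proof -
  define p where "p = a\<^sup>2 / (2 * s2)"
  define q where "q = a / s2"
  have "log_ratio a s2 = (\<lambda>x y z. p * (z * z) + (- p * (y * y) + (- q * (x * z) + q * (x * y))))"
    by (simp add: fun_eq_iff log_ratio_def p_def q_def right_diff_distrib)
  then show ?thesis
    using quad_lipschitz_add[OF quad_lipschitz_cmult[OF quad_lipschitz_monomials(3), of p]
        quad_lipschitz_add[OF quad_lipschitz_cmult[OF quad_lipschitz_monomials(2), of "- p"]
        quad_lipschitz_add[OF quad_lipschitz_cmult[OF quad_lipschitz_monomials(5), of "- q"]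
        quad_lipschitz_cmult[OF quad_lipschitz_monomials(4), of q]]]]
    by auto
qed

lemma quad_lipschitz_log_betting: "\<exists>K. quad_lipschitz K (\<lambda>x y z. log_betting (log_ratio a s2 x y z))"
  using quad_lipschitz_log_ratio[of a s2] quad_lipschitz_compose_lipschitz[OF _ log_betting_lipschitz]
  by blast

lemma measurable_log_ratio [measurable]:
  "(\<lambda>(x, y, z). log_ratio a s2 x y z) \<in> borel_measurable (borel \<Otimes>\<^sub>M borel \<Otimes>\<^sub>M borel)"
  unfolding log_ratio_def by measurable

lemma measurable_log_betting [measurable]: "log_betting \<in> borel_measurable borel"
  unfolding log_betting_def[abs_def] by measurable

text \<open>Linearity in the two coefficients separates the parameter error from the data, whose
  part is dominated by a quadratic with convergent averages.\<close>

lemma log_ratio_diff_le: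
  "\<bar>log_ratio a s2 x y z - log_ratio b r2 x y z\<bar>
    \<le> (\<bar>a\<^sup>2 / (2 * s2) - b\<^sup>2 / (2 * r2)\<bar> + \<bar>a / s2 - b / r2\<bar>) * (1 + x * x + y * y + z * z)"
proof -
  have "log_ratio a s2 x y z - log_ratio b r2 x y z
      = (a\<^sup>2 / (2 * s2) - b\<^sup>2 / (2 * r2)) * (z * z - y * y) - (a / s2 - b / r2) * (x * z - x * y)"
    by (simp add: log_ratio_def left_diff_distrib)
  then have "\<bar>log_ratio a s2 x y z - log_ratio b r2 x y z\<bar>
      \<le> \<bar>a\<^sup>2 / (2 * s2) - b\<^sup>2 / (2 * r2)\<bar> * \<bar>z * z - y * y\<bar> + \<bar>a / s2 - b / r2\<bar> * \<bar>x * z - x * y\<bar>"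
    by (metis abs_mult abs_triangle_ineq4)
  also have "\<dots> \<le> \<bar>a\<^sup>2 / (2 * s2) - b\<^sup>2 / (2 * r2)\<bar> * (1 + x * x + y * y + z * z)
      + \<bar>a / s2 - b / r2\<bar> * (1 + x * x + y * y + z * z)"
  proof (intro add_mono mult_left_mono)
    have sq: "0 \<le> x * x" "0 \<le> y * y" "0 \<le> z * z"
      by auto
    then show "\<bar>z * z - y * y\<bar> \<le> 1 + x * x + y * y + z * z"
      by linarith
    \<comment> \<open>Both signs are needed to bound the absolute values of the cross terms.\<close>
    have "0 \<le> (x - z) * (x - z)" "0 \<le> (x + z) * (x + z)" "0 \<le> (x - y) * (x - y)" "0 \<le> (x + y) * (x + y)"
      by (auto simp del: mult_eq_0_iff)
    then have "2 * \<bar>x * z\<bar> \<le> x * x + z * z" "2 * \<bar>x * y\<bar> \<le> x * x + y * y"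
      by (auto simp: algebra_simps abs_if)
    with sq show "\<bar>x * z - x * y\<bar> \<le> 1 + x * x + y * y + z * z"
      by linarith
  qed auto
  finally show ?thesis
    by (simp add: distrib_right)
qed

section \<open>Least squares estimates as functions of empirical averages\<close>

lemma sum_atLeast2_reindex: "(\<Sum>i = 2..Suc n. f i) = (\<Sum>k<n. f (Suc (Suc k)))"
  by (rule sum.reindex_bij_witness[where i = "\<lambda>k. Suc (Suc k)" and j = "\<lambda>i. i - 2"])
     (auto intro!: arg_cong[where f = f])

lemma sum_atLeast1_reindex: "(\<Sum>i = 1..n. f i) = (\<Sum>k<n. f (Suc k))"
  by (rule sum.reindex_bij_witness[where i = Suc and j = "\<lambda>i. i - 1"]) auto

lemma a_hat_Suc:
  "a_hat x (Suc n) = (\<Sum>k<n. x (Suc k) * x (Suc (Suc k))) / (\<Sum>k<n. x (Suc k) * x (Suc k))"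
  unfolding a_hat_def diff_Suc_1 sum_atLeast2_reindex sum_atLeast1_reindex
  by (simp add: power2_eq_square mult.commute)

text \<open>Expands the residual squares into sums with known averages. The squares from
  \<open>x 2\<close> onwards are written as a full sum minus the first term, so that the same limit
  serves for them and for the denominator of \<open>a_hat\<close>.\<close>

lemma s2_hat_Suc:
  "s2_hat x (Suc n) = ((\<Sum>k<Suc n. x (Suc k) * x (Suc k)) - x 1 * x 1
      - 2 * a_hat x (Suc n) * (\<Sum>k<n. x (Suc k) * x (Suc (Suc k)))
      + (a_hat x (Suc n))\<^sup>2 * (\<Sum>k<n. x (Suc k) * x (Suc k))) / real n"
proof -
  have "(\<Sum>k<n. (x (Suc (Suc k)) - b * x (Suc k))\<^sup>2) = (\<Sum>k<Suc n. x (Suc k) * x (Suc k)) - x 1 * x 1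
      - 2 * b * (\<Sum>k<n. x (Suc k) * x (Suc (Suc k))) + b\<^sup>2 * (\<Sum>k<n. x (Suc k) * x (Suc k))" for b
  proof -
    have "(\<Sum>k<Suc n. x (Suc k) * x (Suc k)) = x 1 * x 1 + (\<Sum>k<n. x (Suc (Suc k)) * x (Suc (Suc k)))"
      by (subst sum.lessThan_Suc_shift) simp
    moreover have "(x (Suc (Suc k)) - b * x (Suc k))\<^sup>2 = x (Suc (Suc k)) * x (Suc (Suc k))
        - 2 * b * (x (Suc k) * x (Suc (Suc k))) + b\<^sup>2 * (x (Suc k) * x (Suc k))" for k
      by (simp add: power2_eq_square algebra_simps)
    ultimately show ?thesis
      by (simp add: sum.distrib sum_subtractf sum_distrib_left)
  qed
  then show ?thesis
    unfolding s2_hat_def diff_Suc_1 sum_atLeast2_reindex by simp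
qed

lemma ar_estimates_consistent:
  fixes x :: "nat \<Rightarrow> real"
  assumes T: "0 < T"
    and A: "(\<lambda>n. (\<Sum>k<n. x (Suc k) * x (Suc k)) / real n) \<longlonglongrightarrow> T"
    and B: "(\<lambda>n. (\<Sum>k<n. x (Suc k) * x (Suc (Suc k))) / real n) \<longlonglongrightarrow> a * T"
  shows "(\<lambda>n. a_hat x (Suc n)) \<longlonglongrightarrow> a"
    and "(\<lambda>n. s2_hat x (Suc n)) \<longlonglongrightarrow> T * (1 - a\<^sup>2)"
    and "\<forall>\<^sub>F n in sequentially. (\<Sum>k<n. x (Suc k) * x (Suc k)) \<noteq> 0"
proof -
  show "\<forall>\<^sub>F n in sequentially. (\<Sum>k<n. x (Suc k) * x (Suc k)) \<noteq> 0"
    using order_tendstoD(1)[OF A T] by eventually_elim auto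
  have "(\<lambda>n. ((\<Sum>k<n. x (Suc k) * x (Suc (Suc k))) / real n) / ((\<Sum>k<n. x (Suc k) * x (Suc k)) / real n)) \<longlonglongrightarrow> a * T / T"
    using T by (intro tendsto_divide A B) auto
  moreover have "\<forall>\<^sub>F n in sequentially. ((\<Sum>k<n. x (Suc k) * x (Suc (Suc k))) / real n) / ((\<Sum>k<n. x (Suc k) * x (Suc k)) / real n)
      = a_hat x (Suc n)"
    using eventually_gt_at_top[of 0] by eventually_elim (simp add: a_hat_Suc)
  ultimately show a: "(\<lambda>n. a_hat x (Suc n)) \<longlonglongrightarrow> a"
    using T Lim_transform_eventually by fastforce
  \<comment> \<open>The factor \<open>1 + 1 / n\<close> is \<open>(n + 1) / n\<close>: it converts
    an average over \<open>n + 1\<close> squares into the division by \<open>n\<close> used in the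
    estimate.\<close>
  have "(\<lambda>n. (\<Sum>k<Suc n. x (Suc k) * x (Suc k)) / real (Suc n) * (1 + 1 / real n) - x 1 * x 1 / real n
      - 2 * a_hat x (Suc n) * ((\<Sum>k<n. x (Suc k) * x (Suc (Suc k))) / real n)
      + (a_hat x (Suc n))\<^sup>2 * ((\<Sum>k<n. x (Suc k) * x (Suc k)) / real n))
    \<longlonglongrightarrow> T * (1 + 0) - 0 - 2 * a * (a * T) + a\<^sup>2 * T"
    by (intro tendsto_add tendsto_diff tendsto_mult tendsto_power tendsto_const a A B
        LIMSEQ_Suc[OF A] lim_const_over_n)
  moreover have "\<forall>\<^sub>F n in sequentially. (\<Sum>k<Suc n. x (Suc k) * x (Suc k)) / real (Suc n) * (1 + 1 / real n) - x 1 * x 1 / real n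
      - 2 * a_hat x (Suc n) * ((\<Sum>k<n. x (Suc k) * x (Suc (Suc k))) / real n)
      + (a_hat x (Suc n))\<^sup>2 * ((\<Sum>k<n. x (Suc k) * x (Suc k)) / real n) = s2_hat x (Suc n)"
    using eventually_gt_at_top[of 0]
  proof eventually_elim
    case (elim n)
    then have "1 + 1 / real n = real (Suc n) / real n"
      by (simp add: field_simps)
    then show ?case
      unfolding s2_hat_Suc by (simp add: diff_divide_distrib add_divide_distrib del: sum.lessThan_Suc of_nat_Suc)
  qed
  ultimately have "(\<lambda>n. s2_hat x (Suc n)) \<longlonglongrightarrow> T * (1 + 0) - 0 - 2 * a * (a * T) + a\<^sup>2 * T"
    by (rule Lim_transform_eventually)
  then show "(\<lambda>n. s2_hat x (Suc n)) \<longlonglongrightarrow> T * (1 - a\<^sup>2)"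
    by (simp add: algebra_simps power2_eq_square)
qed

text \<open>Degenerate estimates give score 1, all others have a positive variance estimate; so the
  logarithm of the wealth is a sum on every path.\<close>

lemma S_hat_pos: "0 < S_hat x t"
  by (auto simp: S_hat_def est_degenerate_def intro!: pair_score_ar_f_pos)

lemma ln_wealth_Suc: "ln (wealth x (Suc n)) = (\<Sum>k<n. ln (S_hat x (2 * k + 3)))"
proof -
  have "ln (wealth x (Suc n)) = (\<Sum>k = 1..n. ln (S_hat x (2 * k + 1)))"
    unfolding wealth_def by (subst ln_prod) (auto simp: order_less_imp_not_eq2[OF S_hat_pos] atLeastLessThanSuc_atLeastAtMost)
  also have "\<dots> = (\<Sum>k<n. ln (S_hat x (2 * k + 3)))"
    unfolding sum_atLeast1_reindex by (simp add: numeral_3_eq_3)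
  finally show ?thesis .
qed

text \<open>A deterministic statement about one path: all probability enters through the four
  assumed limits.\<close>

lemma wealth_growth:
  fixes x :: "nat \<Rightarrow> real"
  assumes T: "0 < T" and a: "\<bar>a\<bar> < 1" and s2: "s2 = T * (1 - a\<^sup>2)"
    and A: "(\<lambda>n. (\<Sum>k<n. x (Suc k) * x (Suc k)) / real n) \<longlonglongrightarrow> T"
    and B: "(\<lambda>n. (\<Sum>k<n. x (Suc k) * x (Suc (Suc k))) / real n) \<longlonglongrightarrow> a * T"
    and W: "(\<lambda>n. (\<Sum>k<n. 1 + x (2 * k + 2) * x (2 * k + 2) + x (2 * k + 3) * x (2 * k + 3)
        + x (2 * k + 4) * x (2 * k + 4)) / real n) \<longlonglongrightarrow> W"
    and L: "(\<lambda>n. (\<Sum>k<n. log_betting (log_ratio a s2 (x (2 * k + 2)) (x (2 * k + 3)) (x (2 * k + 4)))) / real n)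
        \<longlonglongrightarrow> L"
  shows "(\<lambda>n. ln (wealth x n) / real (2 * n)) \<longlonglongrightarrow> 1 / 2 * L"
proof -
  have s2_pos: "0 < s2"
    using T a by (simp add: s2 abs_square_less_1)
  \<comment> \<open>The bet on \<open>x (2 * k + 3)\<close> and \<open>x (2 * k + 4)\<close> uses
    estimates from \<open>2 * k + 2 = Suc (2 * k + 1)\<close> observations.\<close>
  have sub: "filterlim (\<lambda>k. 2 * k + 1 :: nat) sequentially sequentially"
    by (rule filterlim_subseq) (auto simp: strict_mono_def)
  note est = ar_estimates_consistent[OF T A B]
  define ah where "ah k = a_hat x (2 * k + 2)" for k
  define sh where "sh k = s2_hat x (2 * k + 2)" for k
  have ah: "ah \<longlonglongrightarrow> a" and sh: "sh \<longlonglongrightarrow> s2"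
    using filterlim_compose[OF est(1) sub] filterlim_compose[OF est(2) sub]
    by (simp_all add: ah_def[abs_def] sh_def[abs_def] s2)
  have nz: "\<forall>\<^sub>F k in sequentially. (\<Sum>i<2 * k + 1. x (Suc i) * x (Suc i)) \<noteq> 0"
    using est(3) sub unfolding filterlim_iff by blast
  have sh_pos: "\<forall>\<^sub>F k in sequentially. 0 < sh k"
    by (rule order_tendstoD(1)[OF sh s2_pos])
  define \<delta> where "\<delta> k = \<bar>(ah k)\<^sup>2 / (2 * sh k) - a\<^sup>2 / (2 * s2)\<bar> + \<bar>ah k / sh k - a / s2\<bar>" for k
  have "(\<lambda>k. \<bar>(ah k)\<^sup>2 / (2 * sh k) - a\<^sup>2 / (2 * s2)\<bar> + \<bar>ah k / sh k - a / s2\<bar>)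
      \<longlonglongrightarrow> \<bar>a\<^sup>2 / (2 * s2) - a\<^sup>2 / (2 * s2)\<bar> + \<bar>a / s2 - a / s2\<bar>"
    using s2_pos by (intro tendsto_intros ah sh) auto
  then have \<delta>: "\<delta> \<longlonglongrightarrow> 0"
    by (simp add: \<delta>_def[abs_def])
  have "(\<lambda>n. (\<Sum>k<n. ln (S_hat x (2 * k + 3))) / real n) \<longlonglongrightarrow> L"
  proof (rule cesaro_perturbation[OF _ \<delta> _ W L])
    show "\<forall>\<^sub>F k in sequentially. \<bar>ln (S_hat x (2 * k + 3))
        - log_betting (log_ratio a s2 (x (2 * k + 2)) (x (2 * k + 3)) (x (2 * k + 4)))\<bar>
      \<le> \<delta> k * (1 + x (2 * k + 2) * x (2 * k + 2) + x (2 * k + 3) * x (2 * k + 3) + x (2 * k + 4) * x (2 * k + 4))"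
      using nz sh_pos
    proof eventually_elim
      case (elim k)
      have "2 * k + 2 - 1 = 2 * k + 1"
        by simp
      then have "(\<Sum>i = 1..2 * k + 2 - 1. (x i)\<^sup>2) \<noteq> 0"
        using elim(1) by (simp only: sum_atLeast1_reindex power2_eq_square not_False_eq_True)
      then have "\<not> est_degenerate x (2 * k + 2)"
        using elim(2) by (auto simp: est_degenerate_def sh_def)
      then have "ln (S_hat x (2 * k + 3))
          = log_betting (log_ratio (ah k) (sh k) (x (2 * k + 2)) (x (2 * k + 3)) (x (2 * k + 4)))"
        using elim by (simp add: S_hat_def ah_def sh_def ln_pair_score_ar_f eval_nat_numeral)
      then show ?case
        unfolding \<delta>_def
        using order_trans[OF log_betting_lipschitz[unfolded mult_1] log_ratio_diff_le] by simp
    qed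
  qed (auto intro!: add_nonneg_nonneg)
  then have "(\<lambda>n. ln (wealth x (Suc n)) / real n) \<longlonglongrightarrow> L"
    by (simp add: ln_wealth_Suc)
  moreover have "(\<lambda>n. real n / real (Suc n)) \<longlonglongrightarrow> 1"
    by (rule LIMSEQ_n_over_Suc_n)
  \<comment> \<open>Wealth at index \<open>n + 1\<close> is a product of only \<open>n\<close>
    scores, whereas the normalisation is \<open>2 * (n + 1)\<close>.\<close>
  ultimately have "(\<lambda>n. 1 / 2 * (ln (wealth x (Suc n)) / real n * (real n / real (Suc n)))) \<longlonglongrightarrow> 1 / 2 * (L * 1)"
    by (intro tendsto_mult tendsto_const)
  moreover have "\<forall>\<^sub>F n in sequentially. 1 / 2 * (ln (wealth x (Suc n)) / real n * (real n / real (Suc n)))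
      = ln (wealth x (Suc n)) / real (2 * Suc n)"
    using eventually_gt_at_top[of 0] by eventually_elim (simp del: of_nat_Suc mult_Suc_right)
  ultimately have "(\<lambda>n. ln (wealth x (Suc n)) / real (2 * Suc n)) \<longlonglongrightarrow> 1 / 2 * (L * 1)"
    by (rule Lim_transform_eventually)
  then show ?thesis
    by (subst filterlim_sequentially_Suc[symmetric]) simp
qed

section \<open>The growth rate\<close>

text \<open>Exhibits the zero set: for \<open>a \<noteq> 0\<close> the ratio vanishes only on the
  planes \<open>z = y\<close> and \<open>a * (y + z) = 2 * x\<close>.\<close>

lemma log_ratio_factor:
  "s2 \<noteq> 0 \<Longrightarrow> log_ratio a s2 x y z = a / (2 * s2) * ((z - y) * (a * (y + z) - 2 * x))"
  by (simp add: log_ratio_def field_simps power2_eq_square)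

context gaussian_ar1
begin

section \<open>Second-order moments and the joint density of a window\<close>

lemma X_second_moment:
  assumes "1 \<le> t"
  shows "expectation (\<lambda>\<omega>. X t \<omega> * X t \<omega>) = \<tau>\<^sup>2"
proof -
  note D = X_distr[OF assms]
  have "expectation (X t) = 0"
    by (rule normal_distributed_expectation[OF \<tau>_pos D])
  with normal_distributed_variance[OF \<tau>_pos D] show ?thesis
    by (simp add: power2_eq_square)
qed

lemma X_lag_one_moment:
  assumes "1 \<le> t"
  shows "expectation (\<lambda>\<omega>. X t \<omega> * X (Suc t) \<omega>) = a * \<tau>\<^sup>2"
proof -
  note D = X_distr[OF assms]
  have De: "distributed M lborel (eps (Suc t)) (normal_density 0 \<sigma>)"
    using assms by (intro eps_distr) auto
  have iX: "integrable M (X t)"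
    by (rule distributed_integrable_var[OF D _ integrable_normal_moment_nz_1[OF \<tau>_pos]]) simp
  have iE: "integrable M (eps (Suc t))"
    by (rule distributed_integrable_var[OF De _ integrable_normal_moment_nz_1[OF \<sigma>_pos]]) simp
  have iXX: "integrable M (\<lambda>\<omega>. X t \<omega> * X t \<omega>)"
    using integrable_normal_moment[OF \<tau>_pos, of 0 2]
    by (subst distributed_integrable[OF D, of "\<lambda>x. x * x", symmetric]) (auto simp: power2_eq_square)
  note ind = indep_X_eps[OF assms]
  have iXE: "integrable M (\<lambda>\<omega>. X t \<omega> * eps (Suc t) \<omega>)"
    by (rule indep_var_integrable[OF ind iX iE])
  have "expectation (\<lambda>\<omega>. X t \<omega> * X (Suc t) \<omega>)
      = expectation (\<lambda>\<omega>. a * (X t \<omega> * X t \<omega>) + X t \<omega> * eps (Suc t) \<omega>)"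
    using assms by (intro Bochner_Integration.integral_cong) (auto simp: X_Suc algebra_simps)
  also have "\<dots> = a * \<tau>\<^sup>2 + expectation (X t) * expectation (eps (Suc t))"
    using iXX iXE assms by (simp add: X_second_moment indep_var_lebesgue_integral[OF ind iX iE])
  also have "expectation (X t) = 0"
    by (rule normal_distributed_expectation[OF \<tau>_pos D])
  finally show ?thesis
    by simp
qed

text \<open>Identifies \<open>ar_f\<close> as the conditional density of the next two observations
  given the current one.\<close>

lemma ar_f_eq_normal_densities:
  "ar_f a (\<sigma>\<^sup>2) x y z = normal_density 0 \<sigma> (y - a * x) * normal_density 0 \<sigma> (z - a * y)"
proof -
  have "1 / (2 * pi * \<sigma>\<^sup>2) = 1 / sqrt (2 * pi * \<sigma>\<^sup>2) * (1 / sqrt (2 * pi * \<sigma>\<^sup>2))"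
    by simp
  then show ?thesis
    unfolding ar_f_def normal_density_def diff_conv_add_uminus[of "- (y - a * x)\<^sup>2 / (2 * \<sigma>\<^sup>2)"] exp_add
    by simp
qed

text \<open>Passing from noise coordinates to observations is a translation in each inner integral,
  so no Jacobian appears. Values in \<open>ennreal\<close> allow it to be applied to the likelihood
  ratio before that is known to be integrable.\<close>

lemma nn_integral_window:
  fixes h :: "real \<Rightarrow> real \<Rightarrow> real \<Rightarrow> ennreal"
  assumes h [measurable]: "(\<lambda>(x, y, z). h x y z) \<in> borel_measurable (borel \<Otimes>\<^sub>M borel \<Otimes>\<^sub>M borel)"
    and t: "1 \<le> t"
  shows "(\<integral>\<^sup>+\<omega>. h (X t \<omega>) (X (Suc t) \<omega>) (X (Suc (Suc t)) \<omega>) \<partial>M)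
    = (\<integral>\<^sup>+x. normal_density 0 \<tau> x * (\<integral>\<^sup>+y. \<integral>\<^sup>+z. ar_f a (\<sigma>\<^sup>2) x y z * h x y z \<partial>lborel \<partial>lborel) \<partial>lborel)"
proof -
  let ?n = "\<lambda>u. ennreal (normal_density 0 \<sigma> u)"
  let ?N = "density lborel ?n"
  have [measurable]: "X t \<in> borel_measurable M"
    "eps (Suc t) \<in> borel_measurable M" "eps (Suc (Suc t)) \<in> borel_measurable M"
    using t by (auto intro!: X_measurable)
  have [measurable]: "(\<lambda>\<omega>. h (f \<omega>) (g \<omega>) (k \<omega>)) \<in> borel_measurable L"
    if [measurable]: "f \<in> borel_measurable L" "g \<in> borel_measurable L" "k \<in> borel_measurable L"
    for f g k and L :: "'b measure"
  proof -
    have "(\<lambda>\<omega>. (\<lambda>(x, y, z). h x y z) (f \<omega>, g \<omega>, k \<omega>)) \<in> borel_measurable L"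
      by measurable
    then show ?thesis by simp
  qed
  interpret N: prob_space ?N
    by (rule prob_space_normal_density[OF \<sigma>_pos])
  interpret NN: pair_prob_space ?N ?N ..
  \<comment> \<open>Used for both noise terms, with \<open>c = a * u\<close> inside and
    \<open>c = a * x\<close> outside.\<close>
  have shift: "(\<integral>\<^sup>+e. F (c + e) \<partial>?N) = (\<integral>\<^sup>+y. ?n (y - c) * F y \<partial>lborel)"
    if [measurable]: "F \<in> borel_measurable borel" for F and c :: real
    using nn_integral_real_affine[of "\<lambda>y. ?n (y - c) * F y" 1 c] by (simp add: nn_integral_density)
  have inner: "(\<integral>\<^sup>+e'. h x u (a * u + e') \<partial>?N) = (\<integral>\<^sup>+z. ?n (z - a * u) * h x u z \<partial>lborel)" for x u
    by (rule shift) measurable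
  have outer: "(\<integral>\<^sup>+e. (\<integral>\<^sup>+z. ?n (z - a * (a * x + e)) * h x (a * x + e) z \<partial>lborel) \<partial>?N)
      = (\<integral>\<^sup>+y. ?n (y - a * x) * (\<integral>\<^sup>+z. ?n (z - a * y) * h x y z \<partial>lborel) \<partial>lborel)" for x
    by (rule shift[of "\<lambda>y. \<integral>\<^sup>+z. ?n (z - a * y) * h x y z \<partial>lborel"]) measurable
  let ?H = "\<lambda>(x, e, e'). h x (a * x + e) (a * (a * x + e) + e')"
  have fst: "(\<integral>\<^sup>+p. ?H (x, p) \<partial>(?N \<Otimes>\<^sub>M ?N)) = (\<integral>\<^sup>+e. \<integral>\<^sup>+e'. ?H (x, (e, e')) \<partial>?N \<partial>?N)" for x
    by (rule N.nn_integral_fst[symmetric]) measurable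
  have "(\<integral>\<^sup>+\<omega>. h (X t \<omega>) (X (Suc t) \<omega>) (X (Suc (Suc t)) \<omega>) \<partial>M)
      = (\<integral>\<^sup>+\<omega>. ?H (X t \<omega>, eps (Suc t) \<omega>, eps (Suc (Suc t)) \<omega>) \<partial>M)"
    using t by (simp add: X_Suc)
  also have "\<dots> = (\<integral>\<^sup>+p. ?H p \<partial>triple_law)"
    unfolding distr_triple[OF t, symmetric] by (subst nn_integral_distr) measurable
  also have "\<dots> = (\<integral>\<^sup>+x. \<integral>\<^sup>+p. ?H (x, p) \<partial>(?N \<Otimes>\<^sub>M ?N) \<partial>density lborel (normal_density 0 \<tau>))"
    unfolding triple_law_def
    by (rule NN.P.nn_integral_fst[symmetric]) measurable
  also have "\<dots> = (\<integral>\<^sup>+x. \<integral>\<^sup>+e. \<integral>\<^sup>+e'. h x (a * x + e) (a * (a * x + e) + e') \<partial>?N \<partial>?N \<partial>density lborel (normal_density 0 \<tau>))"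
    by (simp only: fst, simp only: prod.case)
  also have "\<dots> = (\<integral>\<^sup>+x. \<integral>\<^sup>+y. ?n (y - a * x) * (\<integral>\<^sup>+z. ?n (z - a * y) * h x y z \<partial>lborel) \<partial>lborel \<partial>density lborel (normal_density 0 \<tau>))"
    by (simp only: inner outer)
  also have "\<dots> = (\<integral>\<^sup>+x. normal_density 0 \<tau> x * (\<integral>\<^sup>+y. ?n (y - a * x) * (\<integral>\<^sup>+z. ?n (z - a * y) * h x y z \<partial>lborel) \<partial>lborel) \<partial>lborel)"
    by (subst nn_integral_density) measurable
  also have "\<dots> = (\<integral>\<^sup>+x. normal_density 0 \<tau> x * (\<integral>\<^sup>+y. \<integral>\<^sup>+z. ar_f a (\<sigma>\<^sup>2) x y z * h x y z \<partial>lborel \<partial>lborel) \<partial>lborel)"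
    by (simp add: ar_f_eq_normal_densities ennreal_mult mult.assoc nn_integral_cmult)
  finally show ?thesis .
qed

text \<open>Multiplying the density by \<open>exp (- D)\<close> exchanges its last two arguments,
  and Tonelli exchanges them back; what remains is the total mass.\<close>

lemma expectation_likelihood_ratio:
  "(\<integral>\<^sup>+\<omega>. ennreal (exp (- window (log_ratio a (\<sigma>\<^sup>2)) 2 \<omega>)) \<partial>M) = 1"
proof -
  have s2: "0 < \<sigma>\<^sup>2" using \<sigma>_pos by simp
  have swap: "(\<integral>\<^sup>+y. \<integral>\<^sup>+z. ennreal (ar_f a (\<sigma>\<^sup>2) x z y) \<partial>lborel \<partial>lborel)
      = (\<integral>\<^sup>+y. \<integral>\<^sup>+z. ennreal (ar_f a (\<sigma>\<^sup>2) x y z) \<partial>lborel \<partial>lborel)" for x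
    by (rule lborel_pair.Fubini'[symmetric]) (simp add: ar_f_def split_beta')
  have change: "ennreal (ar_f a (\<sigma>\<^sup>2) x y z) * ennreal (exp (- log_ratio a (\<sigma>\<^sup>2) x y z))
      = ennreal (ar_f a (\<sigma>\<^sup>2) x z y)" for x y z
    unfolding ar_f_swap[OF s2, where x = x and y = y and z = z]
    by (rule ennreal_mult''[symmetric]) simp
  have "(\<integral>\<^sup>+\<omega>. ennreal (exp (- window (log_ratio a (\<sigma>\<^sup>2)) 2 \<omega>)) \<partial>M)
      = (\<integral>\<^sup>+x. normal_density 0 \<tau> x * (\<integral>\<^sup>+y. \<integral>\<^sup>+z. ar_f a (\<sigma>\<^sup>2) x y z
        * ennreal (exp (- log_ratio a (\<sigma>\<^sup>2) x y z)) \<partial>lborel \<partial>lborel) \<partial>lborel)"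
    unfolding window_def by (rule nn_integral_window) (auto simp: log_ratio_def)
  also have "\<dots> = (\<integral>\<^sup>+x. normal_density 0 \<tau> x * (\<integral>\<^sup>+y. \<integral>\<^sup>+z. ar_f a (\<sigma>\<^sup>2) x z y \<partial>lborel \<partial>lborel) \<partial>lborel)"
    by (simp only: change)
  also have "\<dots> = (\<integral>\<^sup>+x. normal_density 0 \<tau> x * (\<integral>\<^sup>+y. \<integral>\<^sup>+z. ennreal (ar_f a (\<sigma>\<^sup>2) x y z) * 1 \<partial>lborel \<partial>lborel) \<partial>lborel)"
    by (simp add: swap)
  also have "\<dots> = (\<integral>\<^sup>+\<omega>. 1 \<partial>M)"
    by (rule nn_integral_window[where h = "\<lambda>x y z. 1", symmetric]) auto
  also have "\<dots> = 1"
    by (simp add: emeasure_space_1)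
  finally show ?thesis .
qed

text \<open>For fixed \<open>x\<close> and \<open>y\<close> the ratio vanishes for at most two
  values of \<open>z\<close>, a Lebesgue null set.\<close>

lemma AE_log_ratio_nonzero:
  assumes "a \<noteq> 0"
  shows "AE \<omega> in M. window (log_ratio a (\<sigma>\<^sup>2)) 2 \<omega> \<noteq> 0"
proof -
  have s2: "0 < \<sigma>\<^sup>2" using \<sigma>_pos by simp
  have zero: "z = y \<or> z = 2 * x / a - y" if "log_ratio a (\<sigma>\<^sup>2) x y z = 0" for x y z
  proof -
    have "log_ratio a (\<sigma>\<^sup>2) x y z = a / (2 * \<sigma>\<^sup>2) * ((z - y) * (a * (y + z) - 2 * x))"
      using s2 by (intro log_ratio_factor) simp
    then have "z = y \<or> a * (y + z) - 2 * x = 0"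
      using that assms s2 by simp
    then show ?thesis
      using assms by (auto simp: field_simps)
  qed
  have null: "(\<integral>\<^sup>+z. ar_f a (\<sigma>\<^sup>2) x y z * (indicator {0} (log_ratio a (\<sigma>\<^sup>2) x y z) :: ennreal) \<partial>lborel) = 0" for x y
  proof -
    have "AE z in lborel. ar_f a (\<sigma>\<^sup>2) x y z * (indicator {0} (log_ratio a (\<sigma>\<^sup>2) x y z) :: ennreal) = 0"
      using AE_lborel_singleton[of y] AE_lborel_singleton[of "2 * x / a - y"]
      by eventually_elim (use zero in \<open>auto simp: indicator_def\<close>)
    from nn_integral_cong_AE[OF this] show ?thesis
      by simp
  qed
  have [measurable]: "window (log_ratio a (\<sigma>\<^sup>2)) 2 \<in> borel_measurable M"
    by (rule window_measurable) auto
  have "(\<integral>\<^sup>+\<omega>. indicator {0} (window (log_ratio a (\<sigma>\<^sup>2)) 2 \<omega>) \<partial>M)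
      = (\<integral>\<^sup>+x. normal_density 0 \<tau> x * (\<integral>\<^sup>+y. \<integral>\<^sup>+z. ar_f a (\<sigma>\<^sup>2) x y z
        * (indicator {0} (log_ratio a (\<sigma>\<^sup>2) x y z) :: ennreal) \<partial>lborel \<partial>lborel) \<partial>lborel)"
    unfolding window_def by (rule nn_integral_window) (auto simp: log_ratio_def)
  also have "\<dots> = 0"
    by (simp add: null)
  finally have "(\<integral>\<^sup>+\<omega>. indicator {0} (window (log_ratio a (\<sigma>\<^sup>2)) 2 \<omega>) \<partial>M) = 0" .
  then have "AE \<omega> in M. indicator {0} (window (log_ratio a (\<sigma>\<^sup>2)) 2 \<omega>) = (0 :: ennreal)"
    by (subst (asm) nn_integral_0_iff_AE) measurable
  then show ?thesis
    by eventually_elim (auto simp: indicator_def)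
qed

abbreviation score :: "nat \<Rightarrow> 'w \<Rightarrow> real" where
  "score \<equiv> window (\<lambda>x y z. log_betting (log_ratio a (\<sigma>\<^sup>2) x y z))"

lemma score_measurable:
  "(\<lambda>(x, y, z). log_betting (log_ratio a (\<sigma>\<^sup>2) x y z)) \<in> borel_measurable (borel \<Otimes>\<^sub>M borel \<Otimes>\<^sub>M borel)"
proof -
  have "(\<lambda>p. log_betting ((\<lambda>(x, y, z). log_ratio a (\<sigma>\<^sup>2) x y z) p)) \<in> borel_measurable (borel \<Otimes>\<^sub>M borel \<Otimes>\<^sub>M borel)"
    by measurable
  then show ?thesis by (simp add: split_beta')
qed

lemma score_integrable: "integrable M (score 2)"
  using quad_lipschitz_log_betting[of a "\<sigma>\<^sup>2"] score_measurable by (auto intro: window_integrable)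

text \<open>Subtracting \<open>(1 - exp (- D)) / 2\<close>, which has mean 0, from the score leaves
  a nonnegative variable \<open>?d\<close> with the same mean. If that mean is 0, then
  \<open>?d\<close> and with it \<open>D\<close> vanish almost surely, which is impossible for
  \<open>a \<noteq> 0\<close>.\<close>

lemma expectation_score_nonneg: "0 \<le> expectation (score 2)"
  and expectation_score_eq_0_iff: "expectation (score 2) = 0 \<longleftrightarrow> a = 0"
proof -
  let ?D = "window (log_ratio a (\<sigma>\<^sup>2)) 2"
  have [measurable]: "?D \<in> borel_measurable M"
    by (rule window_measurable) auto
  have score: "score 2 \<omega> = log_betting (?D \<omega>)" for \<omega>
    by (simp add: window_def)
  have ie: "integrable M (\<lambda>\<omega>. exp (- ?D \<omega>))"
    using expectation_likelihood_ratio by (intro integrableI_nonneg) auto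
  have Ee: "expectation (\<lambda>\<omega>. exp (- ?D \<omega>)) = 1"
    using expectation_likelihood_ratio by (subst integral_eq_nn_integral) auto
  let ?d = "\<lambda>\<omega>. score 2 \<omega> - (1 - exp (- ?D \<omega>)) / 2"
  have id: "integrable M ?d"
    using score_integrable ie by simp
  have Ed: "expectation ?d = expectation (score 2)"
    using score_integrable ie Ee by (simp add: prob_space)
  have d0: "0 \<le> ?d \<omega>" for \<omega>
    using log_betting_ge[of "?D \<omega>"] by (simp add: score)
  show "0 \<le> expectation (score 2)"
    unfolding Ed[symmetric] using d0 by (intro Bochner_Integration.integral_nonneg) auto
  show "expectation (score 2) = 0 \<longleftrightarrow> a = 0"
  proof
    assume "expectation (score 2) = 0"
    then have "expectation ?d = 0"
      using Ed by simp
    then have "AE \<omega> in M. ?d \<omega> = 0"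
      using d0 by (subst (asm) integral_nonneg_eq_0_iff_AE[OF id]) auto
    then have z: "AE \<omega> in M. ?D \<omega> = 0"
      by eventually_elim (rule log_betting_eq_imp, simp add: score)
    show "a = 0"
    proof (rule ccontr)
      assume "a \<noteq> 0"
      from AE_log_ratio_nonzero[OF this] z have "AE \<omega> in M. False"
        by eventually_elim simp
      then show False
        by simp
    qed
  next
    assume "a = 0"
    then show "expectation (score 2) = 0"
      by (simp add: window_def[abs_def] log_ratio_def log_betting_def)
  qed
qed

lemma AE_wealth_growth:
  "AE \<omega> in M. (\<lambda>n. ln (wealth (\<lambda>i. X i \<omega>) n) / real (2 * n)) \<longlonglongrightarrow> 1 / 2 * expectation (score 2)"
proof -
  have A: "AE \<omega> in M. (\<lambda>n. (\<Sum>k<n. X (Suc k) \<omega> * X (Suc k) \<omega>) / real n) \<longlonglongrightarrow> \<tau>\<^sup>2"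
    using window_slln[OF quad_lipschitz_monomials(1), of 1 1] by (simp add: window_def[abs_def] X_second_moment split_beta')
  have B: "AE \<omega> in M. (\<lambda>n. (\<Sum>k<n. X (Suc k) \<omega> * X (Suc (Suc k)) \<omega>) / real n) \<longlonglongrightarrow> a * \<tau>\<^sup>2"
    using window_slln[OF quad_lipschitz_monomials(4), of 1 1] X_lag_one_moment[of 2] by (simp add: window_def[abs_def] split_beta' eval_nat_numeral)
  \<comment> \<open>The weights of the plug-in error, sampled at the same times
    \<open>2 * k + 2\<close> as the scores; only the existence of a limit matters.\<close>
  have W: "AE \<omega> in M. (\<lambda>n. (\<Sum>k<n. window (\<lambda>x y z. 1 + (x * x + (y * y + z * z))) (2 * k + 2) \<omega>) / real n)
      \<longlonglongrightarrow> expectation (window (\<lambda>x y z. 1 + (x * x + (y * y + z * z))) 2)"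
    by (rule window_slln[OF quad_lipschitz_add[OF quad_lipschitz_const quad_lipschitz_add[OF quad_lipschitz_monomials(1)
        quad_lipschitz_add[OF quad_lipschitz_monomials(2) quad_lipschitz_monomials(3)]]]]) auto
  obtain K where K: "quad_lipschitz K (\<lambda>x y z. log_betting (log_ratio a (\<sigma>\<^sup>2) x y z))"
    using quad_lipschitz_log_betting by blast
  have L: "AE \<omega> in M. (\<lambda>n. (\<Sum>k<n. score (2 * k + 2) \<omega>) / real n) \<longlonglongrightarrow> expectation (score 2)"
    by (rule window_slln[OF K score_measurable]) auto
  have s2: "\<sigma>\<^sup>2 = \<tau>\<^sup>2 * (1 - a\<^sup>2)"
    using \<tau>2 by (simp add: algebra_simps)
  from A B W L show ?thesis
  proof eventually_elim
    case (elim \<omega>)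
    have idx: "Suc (2 * k + 2) = 2 * k + 3" "Suc (2 * k + 3) = 2 * k + 4" for k
      by simp_all
    show ?case
      using elim \<tau>_pos
      by (intro wealth_growth[OF _ a_bound s2]) (simp_all only: window_def idx add.assoc zero_less_power)
  qed
qed

end

theorem theorem2p5:
  fixes M :: "'w measure" and X eps :: "nat \<Rightarrow> 'w \<Rightarrow> real" and a \<sigma> :: real
  assumes "prob_space M"
    and "\<bar>a\<bar> < 1" and "\<sigma> > 0"
    and "prob_space.indep_vars M (\<lambda>_. borel) eps {1..}"
    and "distributed M lborel (eps 1) (normal_density 0 (\<sigma> / sqrt (1 - a\<^sup>2)))"
    and "\<And>t. t \<ge> 2 \<Longrightarrow> distributed M lborel (eps t) (normal_density 0 \<sigma>)"
    and "X 1 = eps 1"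
    and "\<And>t. t \<ge> 1 \<Longrightarrow> X (t + 1) = (\<lambda>\<omega>. a * X t \<omega> + eps (t + 1) \<omega>)"
  defines "r \<equiv> 1 / 2 * prob_space.expectation M
          (\<lambda>\<omega>. ln (pair_score (ar_f a (\<sigma>\<^sup>2)) (X 2 \<omega>) (X 3 \<omega>) (X 4 \<omega>)))"
  shows "integrable M (\<lambda>\<omega>. ln (pair_score (ar_f a (\<sigma>\<^sup>2)) (X 2 \<omega>) (X 3 \<omega>) (X 4 \<omega>)))
    \<and> (AE \<omega> in M. (\<lambda>n. ln (wealth (\<lambda>i. X i \<omega>) n) / real (2 * n)) \<longlonglongrightarrow> r)
    \<and> r \<ge> 0
    \<and> (r = 0 \<longleftrightarrow> a = 0)"
proof -
  interpret gaussian_ar1 M X eps a \<sigma>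
    using assms(1-8) by (simp add: gaussian_ar1_def gaussian_ar1_axioms_def)
  have "(\<lambda>\<omega>. ln (pair_score (ar_f a (\<sigma>\<^sup>2)) (X 2 \<omega>) (X 3 \<omega>) (X 4 \<omega>))) = score 2"
    using \<sigma>_pos by (simp add: fun_eq_iff ln_pair_score_ar_f window_def eval_nat_numeral)
  then show ?thesis
    using score_integrable AE_wealth_growth expectation_score_nonneg expectation_score_eq_0_iff
    by (simp add: r_def)
qed

end
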